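(* For each $k\in\mathbb{N}_0$ and $\xi_1,\xi_2\in M$ there exists a positive measure $\boldsymbol{\gamma}_{k,\xi_1,\xi_2}$ on $M$ (not depending on $\lambda$) such that the product $w_{k,\lambda}(\xi_1)\,w_{k,\lambda}(\xi_2)$ admits the integral representation $$w_{k,\lambda}(\xi_1)\,w_{k,\lambda}(\xi_2)=\int_Mw_{k,\lambda}(\xi_3)\,\boldsymbol{\gamma}_{k,\xi_1,\xi_2}(d\xi_3),\qquad \xi_1,\xi_2\in M,\ \lambda\in\mathbb{C}.$$
   Context: Notation: $\mathbb{R}^+=(0,\infty)$, $\mathbb{R}_0^+=[0,\infty)$, $\mathbb{N}_0=\{0,1,2,\dots\}$, $\mathbb{T}=\mathbb{R}/\mathbb{Z}$, $M=\mathbb{R}_0^+\times\mathbb{T}$, points of $M$ written $\xi=(x,\theta)$. Standing assumption: $A\in \mathrm{C}(\mathbb{R}_0^+)\cap \mathrm{C}^1(\mathbb{R}^+)$, $A(x)>0$ for $x>0$, $\int_0^1\frac{dx}{A(x)}<\infty$, and $A'/A$ is nonnegative and decreasing (not necessarily strictly). For $k\in\mathbb{Z}$ and $\lambda\in\mathbb{C}$, $v_{k,\lambda}$ denotes the unique solution, continuous on $\mathbb{R}_0^+$, of $$-v''(x)-\frac{A'(x)}{A(x)}v'(x)+\frac{(2k\pi)^2}{A(x)^2}v(x)=\lambda v(x)\ (x>0),\qquad v(0)=1,\qquad \lim_{x\downarrow0}A(x)v'(x)=0,$$ and $w_{k,\lambda}(x,\theta)=e^{i2k\pi\theta}v_{k,\lambda}(x)$.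 These are the separable solutions of $-\Delta u=\lambda u$, where $\Delta=\partial_x^2+\frac{A'}{A}\partial_x+\frac1{A^2}\partial_\theta^2$ is the Laplace-Beltrami operator of $g=dx^2+A(x)^2d\theta^2$ on $M$. *)

theory Defs
  imports "HOL-Analysis.Analysis"
begin

definition int_cong :: "real \<Rightarrow> real \<Rightarrow> bool" where
  "int_cong s t \<longleftrightarrow> s - t \<in> \<int>"

lemma equivp_int_cong: "equivp int_cong"
proof (rule equivpI)
  show "reflp int_cong" by (simp add: reflp_def int_cong_def)
  show "symp int_cong"
  proof (rule sympI)
    fix s t assume "int_cong s t"
    then have "- (s - t) \<in> \<int>" unfolding int_cong_def by (rule Ints_minus)
    then show "int_cong t s" by (simp add: int_cong_def)
  qed
  show "transp int_cong"
  proof (rule transpI)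
    fix s t u assume "int_cong s t" "int_cong t u"
    then have "(s - t) + (t - u) \<in> \<int>" unfolding int_cong_def by (rule Ints_add)
    then show "int_cong s u" by (simp add: int_cong_def)
  qed
qed

text \<open>The circle \<open>\<real>/\<int>\<close>, carrying the quotient topology.\<close>

quotient_type circle = real / int_cong
  by (rule equivp_int_cong)

instantiation circle :: topological_space
begin

definition open_circle :: "circle set \<Rightarrow> bool" where
  "open_circle U \<longleftrightarrow> open (abs_circle -` U)"

instance
proof
  show "open (UNIV :: circle set)" by (simp add: open_circle_def)
  show "open (S \<inter> T)" if "open S" "open T" for S T :: "circle set"
    using that by (simp add: open_circle_def open_Int)
  show "open (\<Union>K)" if "\<forall>S\<in>K. open S" for K :: "circle set set"
    using that by (auto simp: open_circle_def vimage_Union)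
qed

end

lift_definition circle_char :: "int \<Rightarrow> circle \<Rightarrow> complex" is
  "\<lambda>k \<theta>. exp (\<i> * of_real (2 * of_int k * pi * \<theta>))"
proof -
  fix k :: int and s t :: real
  assume "int_cong s t"
  then obtain n :: int where "s - t = of_int n"
    unfolding int_cong_def by (elim Ints_cases)
  then have n: "s = t + of_int n" by simp
  have "\<i> * complex_of_real (2 * of_int k * pi * s)
      = \<i> * of_real (2 * of_int k * pi * t) + of_real (of_int (2 * (k * n)) * pi) * \<i>"
    by (simp add: n algebra_simps)
  then show "exp (\<i> * complex_of_real (2 * of_int k * pi * s))
      = exp (\<i> * of_real (2 * of_int k * pi * t))"
    unfolding exp_eq by blast
qed

definition cone_mfd :: "(real \<times> circle) set" where
  "cone_mfd = {0..} \<times> UNIV"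

definition radial_solution ::
    "(real \<Rightarrow> real) \<Rightarrow> int \<Rightarrow> complex \<Rightarrow> (real \<Rightarrow> complex) \<Rightarrow> bool" where
  "radial_solution A k lam v \<longleftrightarrow>
     continuous_on {0..} v \<and> v 0 = 1 \<and>
     (\<exists>v' v''.
        (\<forall>x>0. (v has_vector_derivative v' x) (at x) \<and>
               (v' has_vector_derivative v'' x) (at x) \<and>
               - v'' x - (deriv A x / A x) *\<^sub>R v' x
                 + ((2 * of_int k * pi)\<^sup>2 / (A x)\<^sup>2) *\<^sub>R v x = lam * v x) \<and>
        ((\<lambda>x. A x *\<^sub>R v' x) \<longlongrightarrow> 0) (at_right 0))"

text \<open>The equation only determines \<open>v\<close> on \<open>[0,\<infinity>)\<close>; the value \<open>0\<close> is prescribed on the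
  negative half-line so that the definite description denotes a unique function.\<close>

definition v_fun :: "(real \<Rightarrow> real) \<Rightarrow> int \<Rightarrow> complex \<Rightarrow> real \<Rightarrow> complex" where
  "v_fun A k lam = (THE v. radial_solution A k lam v \<and> (\<forall>x<0. v x = 0))"

definition w_fun :: "(real \<Rightarrow> real) \<Rightarrow> int \<Rightarrow> complex \<Rightarrow> real \<times> circle \<Rightarrow> complex" where
  "w_fun A k lam \<xi> = circle_char k (snd \<xi>) * v_fun A k lam (fst \<xi>)"

end

theory Submission
  imports Defs "HOL-Probability.Probability"
begin

text \<open>
  Taking \<open>\<gamma>\<close> supported on the circle \<open>\<theta> = \<theta>\<^sub>1 + \<theta>\<^sub>2\<close> reduces the claim to a product formula for the radial
  factors \<open>v\<close>, with a positive measure that serves all \<open>\<lambda>\<close> at once. The radial equation is discretized on the grid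
  \<open>hn\<close> so that log-concavity of \<open>A\<close> and monotonicity of the potential \<open>(2k\<pi>)\<^sup>2/A\<^sup>2\<close> survive. For the discrete
  equation \<open>\<phi>\<^sub>m \<phi>\<^sub>n\<close> is a linear combination of the \<open>\<phi>\<^sub>i\<close>, \<open>i \<le> m + n\<close>, with coefficients that do not depend
  on \<open>\<lambda>\<close>; they solve a discrete wave equation, and a maximum principle of Szwarc's type shows that they are nonnegative.
  Dividing by the solution for \<open>\<lambda> = 0\<close>, which tends to \<open>cosh (2k\<pi> S)\<close> with \<open>S(x) = \<integral>\<^sub>0\<^sup>x 1/A\<close>, turns
  the coefficients into probability weights on a fixed compact interval. As \<open>h\<close> tends to \<open>0\<close>, Helly's theorem gives
  a weak limit of these weights, and the discrete solutions converge locally uniformly to \<open>v\<close> for every \<open>\<lambda>\<close>.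
\<close>

section \<open>Positivity of product coefficients for discrete Sturm--Liouville operators\<close>

text \<open>The continuous wave equation behind the product formula has coefficients that may be
  singular on the boundary: near 0 the function 1/A is only integrable, and A may vanish at 0. On a
  grid the same equation is a finite recursion, and this difficulty is postponed to the convergence
  proof. The coefficients are free of \<lambda> because the operator acting in m and the operator
  acting in n multiply the product by the same eigenvalue, which cancels. Without the division by
  the solution at \<lambda> = 0 the coefficients need not sum to 1 when k is nonzero; after it, the
  identity at \<lambda> = 0 itself fixes the total mass. The index bound m + n is finite speed of
  propagation, and it is what makes the weights tight. Convergence up to the singular end rests on
  taking S as time: for the pair v and A v' the system then has the coefficient (2k\<pi>)^2 -
  \<lambda> A^2, which is continuous up to 0. The grid uses increments of this time, so the total
  step length on a bounded interval stays bounded.\<close>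

lemma sum_atMost_Suc_Suc_split:
  fixes f :: "nat \<Rightarrow> 'a::comm_monoid_add"
  shows "(\<Sum>t\<le>Suc (Suc K). f t) = f 0 + (\<Sum>t\<le>K. f (Suc t)) + f (Suc (Suc K))"
  by (subst sum.atMost_Suc, subst sum.atMost_Suc_shift) simp

text \<open>Discrete counterparts of the data: \<open>b_mono\<close> stands for A'/A nonnegative,
  \<open>b_log_concave\<close> for A'/A decreasing, and \<open>q_antimono\<close> for 1/A^2 being
  nonincreasing. Log-concavity compares the ratios \<open>b (Suc i) / b i\<close> at two arbitrary
  sites, because the two ends of a characteristic triangle are far apart.\<close>

locale discrete_sturm_liouville =
  fixes b q :: "nat \<Rightarrow> real"
  assumes b_pos: "b n > 0"
    and b_mono: "i \<le> j \<Longrightarrow> b i \<le> b j"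
    and b_log_concave: "i \<le> j \<Longrightarrow> b i * b (Suc j) \<le> b (Suc i) * b j"
    and q_nonneg: "q n \<ge> 0"
    and q_antimono: "i \<le> j \<Longrightarrow> q j \<le> q i"
begin

text \<open>\<open>b n\<close> is the conductance of the edge from \<open>n\<close> to \<open>n + 1\<close>, and \<open>b' n\<close> that of the edge from
  \<open>n - 1\<close> to \<open>n\<close>. Since \<open>b' 0 = 0\<close>, the truncated \<open>n - 1\<close> is harmless at \<open>n = 0\<close> in \<open>lap\<close>.\<close>

definition b' :: "nat \<Rightarrow> real" where
  "b' n = (case n of 0 \<Rightarrow> 0 | Suc i \<Rightarrow> b i)"

definition W :: "nat \<Rightarrow> real" where
  "W n = b n + b' n"

definition lap :: "(nat \<Rightarrow> 'a::real_vector) \<Rightarrow> nat \<Rightarrow> 'a" where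
  "lap u n = (b n *\<^sub>R (u (Suc n) - u n) - b' n *\<^sub>R (u n - u (n - 1))) /\<^sub>R W n - q n *\<^sub>R u n"

lemma b'_0 [simp]: "b' 0 = 0" and b'_Suc [simp]: "b' (Suc n) = b n"
  by (simp_all add: b'_def)

lemma b'_nonneg: "b' n \<ge> 0"
  using b_pos by (cases n) (auto intro: less_imp_le)

lemma W_pos: "W n > 0"
  using b_pos[of n] b'_nonneg[of n] by (simp add: W_def)

text \<open>In terms of the walk with conductances \<open>b\<close>: the probability of stepping
  right decreases along the line. After cross-multiplication the common term
  \<open>b j * b r\<close> cancels and log-concavity is left.\<close>

lemma right_conductance_le:
  assumes "j \<le> r"
  shows "W j * b r \<le> b j * W r"
proof -
  have "b' j * b r \<le> b j * b' r"
  proof (cases j)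
    case 0
    then show ?thesis using b_pos[of 0] b'_nonneg[of r] by simp
  next
    case (Suc i)
    with assms obtain s where "r = Suc s" "i \<le> s" by (cases r) auto
    then show ?thesis using b_log_concave[of i s] Suc by simp
  qed
  then show ?thesis by (simp add: W_def algebra_simps)
qed

text \<open>Since \<open>b\<close> increases, a step to the right has probability at least 1/2 at
  every site and a step to the left at most 1/2.\<close>

lemma left_conductance_le:
  assumes "j \<le> l"
  shows "W j * b' l \<le> b j * W l"
proof -
  have "b' j * b' l \<le> b j * b l"
  proof (rule mult_mono)
    show "b' j \<le> b j" using b_mono[of "j - 1" j] b_pos[of j] by (cases j) auto
    show "b' l \<le> b l" using b_mono[of "l - 1" l] b_pos[of l] by (cases l) auto
  qed (use b_pos[of j] b'_nonneg[of l] in auto)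
  then show ?thesis by (simp add: W_def algebra_simps)
qed

text \<open>Regrouping by the receiving site: because \<open>b' (Suc i) = b i\<close>, every
  interior site collects \<open>b + b' = W\<close>, while each of the two end sites misses the
  contribution of its outer neighbour.\<close>

lemma sum_neighbours:
  "(\<Sum>t\<le>K. b (l + Suc (2 * t)) * g (l + 2 * Suc t) + b' (l + Suc (2 * t)) * g (l + 2 * t))
    = (\<Sum>t\<le>Suc K. W (l + 2 * t) * g (l + 2 * t))
      - b' l * g l - b (l + 2 * Suc K) * g (l + 2 * Suc K)"
  by (induction K) (simp_all add: W_def algebra_simps)

text \<open>The wave equation is summed over the backward characteristic triangle of \<open>(i, n)\<close> with weights
  \<open>W i * W j\<close>, row by row. For row \<open>j\<close>, \<open>Z j\<close> is the weighted sum of \<open>u\<close> and \<open>bnd j\<close> the defect at its two ends;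
  the flux between consecutive rows is nonnegative up to this defect.\<close>

theorem maximum_principle:
  fixes u :: "nat \<Rightarrow> nat \<Rightarrow> real"
  assumes wave: "\<And>i j. lap (\<lambda>i. u i j) i = lap (u i) j"
    and init: "\<And>i. u i 0 \<ge> 0"
  shows "j \<le> i \<Longrightarrow> u i j \<ge> 0"
proof (induction j arbitrary: i rule: less_induct)
  case (less n')
  show ?case
  proof (cases n')
    case 0
    then show ?thesis using init by simp
  next
    case (Suc n)
    have IH: "u i j \<ge> 0" if "j \<le> n" "j \<le> i" for i j
      using less.IH that Suc by simp
    define d where "d = i - Suc n"
    have i: "i = d + Suc n" using less.prems Suc by (simp add: d_def)
    \<comment> \<open>The wave equation multiplied by \<open>W i * W j\<close>. The diagonal terms
      are equal on both sides since \<open>W = b + b'\<close>, so only the difference of the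
      potentials survives, and \<open>j \<le> i\<close> gives it the right sign.\<close>
    have cell: "W i * b j * u i (Suc j) + b' j * (W i * u i (j - 1))
        - W j * (b i * u (Suc i) j + b' i * u (i - 1) j) \<ge> 0" if "j \<le> n" "j \<le> i" for i j
    proof -
      have "W i * b j * u i (Suc j) + b' j * (W i * u i (j - 1))
        - W j * (b i * u (Suc i) j + b' i * u (i - 1) j) = W i * W j * (q j - q i) * u i j"
      proof -
        have "(b i * (u (Suc i) j - u i j) - b' i * (u i j - u (i - 1) j)) / W i - q i * u i j
          = (b j * (u i (Suc j) - u i j) - b' j * (u i j - u i (j - 1))) / W j - q j * u i j"
          using wave[of j i] by (simp add: lap_def divide_inverse mult.commute)
        then have "W j * (b i * (u (Suc i) j - u i j) - b' i * (u i j - u (i - 1) j)) - W i * W j * q i * u i j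
          = W i * (b j * (u i (Suc j) - u i j) - b' j * (u i j - u i (j - 1))) - W i * W j * q j * u i j"
          using W_pos[of i] W_pos[of j] by (simp add: field_simps)
        moreover have "W i * u i j * b j + W i * u i j * b' j = W j * u i j * b i + W j * u i j * b' i"
          by (simp add: W_def algebra_simps)
        ultimately show ?thesis
          by (simp add: algebra_simps)
      qed
      also have "\<dots> \<ge> 0"
        using W_pos[of i] W_pos[of j] q_antimono[OF that(2)] IH[OF that] by simp
      finally show ?thesis .
    qed
    \<comment> \<open>Row \<open>j\<close> of the triangle consists of \<open>l j\<close>,
      \<open>l j + 2\<close>, ..., \<open>r j\<close>. It loses one unit at each end per step in
      \<open>j\<close> and shrinks to the single site \<open>i\<close> at \<open>j = Suc n\<close>.
      As \<open>l j \<ge> j\<close>, the triangle stays where the induction hypothesis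
      applies.\<close>
    define l where "l j = d + j" for j
    define r where "r j = d + j + 2 * (Suc n - j)" for j
    define Z where "Z j = (\<Sum>t\<le>Suc n - j. W (l j + 2 * t) * u (l j + 2 * t) j)" for j
    define bnd where "bnd j = b (r j) * u (r j) j + b' (l j) * u (l j) j" for j
    \<comment> \<open>\<open>cell\<close> summed over the sites of row \<open>Suc j\<close>, which
      lie between those of row \<open>j\<close>; \<open>sum_neighbours\<close> then produces
      \<open>Z j - bnd j\<close>.\<close>
    have row: "b j * Z (Suc j) + b' j * (\<Sum>t\<le>n - j. W (d + Suc j + 2 * t) * u (d + Suc j + 2 * t) (j - 1))
        - W j * (Z j - bnd j) \<ge> 0" if "j \<le> n" for j
    proof -
      have "0 \<le> (\<Sum>t\<le>n - j. W (d + Suc j + 2 * t) * b j * u (d + Suc j + 2 * t) (Suc j)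
          + b' j * (W (d + Suc j + 2 * t) * u (d + Suc j + 2 * t) (j - 1))
          - W j * (b (d + Suc j + 2 * t) * u (Suc (d + Suc j + 2 * t)) j
              + b' (d + Suc j + 2 * t) * u (d + Suc j + 2 * t - 1) j))"
        by (intro sum_nonneg cell) (use that in auto)
      also have "\<dots> = b j * Z (Suc j)
          + b' j * (\<Sum>t\<le>n - j. W (d + Suc j + 2 * t) * u (d + Suc j + 2 * t) (j - 1))
          - W j * (\<Sum>t\<le>n - j. b (l j + Suc (2 * t)) * u (l j + 2 * Suc t) j
              + b' (l j + Suc (2 * t)) * u (l j + 2 * t) j)"
        by (simp add: Z_def l_def sum.distrib sum_subtractf sum_distrib_left algebra_simps)
      also have "(\<Sum>t\<le>n - j. b (l j + Suc (2 * t)) * u (l j + 2 * Suc t) j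
              + b' (l j + Suc (2 * t)) * u (l j + 2 * t) j) = Z j - bnd j"
        unfolding sum_neighbours[where g = "\<lambda>i. u i j"] Z_def bnd_def
        using that by (simp add: Suc_diff_le r_def l_def)
      finally show ?thesis .
    qed
    \<comment> \<open>The defect of a row is paid for by its own two end terms; this is where
      monotonicity and log-concavity of \<open>b\<close> enter.\<close>
    have absorb: "W j * bnd j \<le> b j * (W (l j) * u (l j) j + W (r j) * u (r j) j)" if "j \<le> n" for j
    proof -
      have "W j * b (r j) * u (r j) j \<le> b j * W (r j) * u (r j) j"
        by (intro mult_right_mono right_conductance_le IH) (use that in \<open>auto simp: r_def\<close>)
      moreover have "W j * b' (l j) * u (l j) j \<le> b j * W (l j) * u (l j) j"
        by (intro mult_right_mono left_conductance_le IH) (use that in \<open>auto simp: l_def\<close>)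
      ultimately show ?thesis by (simp add: bnd_def algebra_simps)
    qed
    \<comment> \<open>In the step, \<open>W (Suc j) = b (Suc j) + b j\<close> splits the row
      inequality into the flux at \<open>Suc j\<close> and the flux at \<open>j\<close>. The sum
      over row \<open>j\<close> occurring there is \<open>Z j\<close> without its two end terms, and
      exactly these absorb \<open>bnd j\<close>.\<close>
    have flux: "b j * (Z (Suc j) - Z j) + W j * bnd j \<ge> 0" if "j \<le> n" for j
      using that
    proof (induction j)
      case 0
      then show ?case using row[of 0] by (simp add: W_def algebra_simps)
    next
      case (Suc j)
      then have jn: "j \<le> n" by simp
      have "Suc n - j = Suc (Suc (n - Suc j))" using Suc.prems by simp
      then have "Z j = W (l j) * u (l j) j + W (r j) * u (r j) j
          + (\<Sum>t\<le>n - Suc j. W (d + Suc (Suc j) + 2 * t) * u (d + Suc (Suc j) + 2 * t) j)"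
        using sum_atMost_Suc_Suc_split[of "\<lambda>t. W (l j + 2 * t) * u (l j + 2 * t) j" "n - Suc j"]
        by (simp add: Z_def l_def r_def)
      then have "b (Suc j) * Z (Suc (Suc j))
          + b j * (Z j - W (l j) * u (l j) j - W (r j) * u (r j) j)
          - W (Suc j) * (Z (Suc j) - bnd (Suc j)) \<ge> 0"
        using row[of "Suc j"] Suc.prems by simp
      then show ?case
        using Suc.IH[OF jn] absorb[OF jn] by (simp add: W_def algebra_simps)
    qed
    \<comment> \<open>Row \<open>n\<close> has only its two end sites, so \<open>absorb\<close>
      bounds the whole defect by \<open>b n * Z n\<close> and the flux inequality leaves
      \<open>Z (Suc n) \<ge> 0\<close>.\<close>
    have "Z n = W (l n) * u (l n) n + W (r n) * u (r n) n"
      by (simp add: Z_def l_def r_def)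
    then have "b n * Z (Suc n) \<ge> 0"
      using flux[of n] absorb[of n] by (simp add: algebra_simps)
    then have "Z (Suc n) \<ge> 0"
      using b_pos[of n] by (simp add: zero_le_mult_iff)
    then have "W i * u i (Suc n) \<ge> 0"
      by (simp add: Z_def l_def i)
    then show ?thesis
      using W_pos[of i] Suc by (simp add: zero_le_mult_iff)
  qed
qed

section \<open>Linearization coefficients of products of eigenfunctions\<close>

text \<open>The coefficient of the \<open>i\<close>-th eigenfunction in the product of those with
  indices \<open>m\<close> and \<open>n\<close>. The recursion is the wave equation in
  \<open>(m, n)\<close> solved for row \<open>Suc n\<close>, started from the unit mass at
  \<open>i\<close>.\<close>

fun trans_kernel :: "nat \<Rightarrow> nat \<Rightarrow> nat \<Rightarrow> real" where
  "trans_kernel 0 m i = (if i = m then 1 else 0)"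
| "trans_kernel (Suc n) m i = trans_kernel n m i
     + (b' n * (trans_kernel n m i - trans_kernel (n - 1) m i)
        + W n * (lap (\<lambda>m. trans_kernel n m i) m + q n * trans_kernel n m i)) / b n"

lemma trans_kernel_wave:
  "lap (\<lambda>m. trans_kernel n m i) m = lap (\<lambda>n. trans_kernel n m i) n"
proof -
  have "lap (\<lambda>n. trans_kernel n m i) n = (b' n * (trans_kernel n m i - trans_kernel (n - 1) m i)
        + W n * (lap (\<lambda>m. trans_kernel n m i) m + q n * trans_kernel n m i)
        - b' n * (trans_kernel n m i - trans_kernel (n - 1) m i)) / W n - q n * trans_kernel n m i"
    using b_pos[of n] W_pos[of n] by (subst lap_def) (simp add: field_simps)
  also have "\<dots> = lap (\<lambda>m. trans_kernel n m i) m"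
    using W_pos[of n] by simp
  finally show ?thesis by simp
qed

lemma trans_kernel_nonneg: "n \<le> m \<Longrightarrow> trans_kernel n m i \<ge> 0"
  using maximum_principle[of "\<lambda>m n. trans_kernel n m i" n m] trans_kernel_wave by simp

text \<open>Both sides obey the same recursion in \<open>n\<close>. Row \<open>n\<close> at
  \<open>m\<close> refers to row \<open>n - 1\<close> at sites up to \<open>Suc m\<close>, so the
  bound \<open>m + n \<le> N\<close> passes to the induction hypothesis.\<close>

lemma trans_kernel_mult:
  fixes \<phi> :: "nat \<Rightarrow> complex"
  assumes eigen: "\<And>n. lap \<phi> n = - \<mu> * \<phi> n" and "\<phi> 0 = 1" and "m + n \<le> N"
  shows "(\<Sum>i\<le>N. trans_kernel n m i *\<^sub>R \<phi> i) = \<phi> m * \<phi> n"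
  using assms(3)
proof (induction n arbitrary: m rule: less_induct)
  case (less n)
  show ?case
  proof (cases n)
    case 0
    then have "(\<Sum>i\<le>N. trans_kernel n m i *\<^sub>R \<phi> i) = (\<Sum>i\<le>N. if i = m then \<phi> i else 0)"
      by (intro sum.cong) auto
    then show ?thesis using less.prems 0 assms(2) by simp
  next
    case (Suc p)
    define F where "F p m = (\<Sum>i\<le>N. trans_kernel p m i *\<^sub>R \<phi> i)" for p m
    have lin: "(\<Sum>i\<le>N. lap (\<lambda>m. trans_kernel p m i) m *\<^sub>R \<phi> i) = lap (F p) m"
      by (simp add: F_def lap_def scaleR_sum_right scaleR_diff_left scaleR_diff_right sum_subtractf
        mult.assoc flip: scaleR_scaleR)
    have lap_F: "lap (F p) m = \<phi> p * lap \<phi> m"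
    proof -
      have "F p j = \<phi> p * \<phi> j" if "j \<le> Suc m" for j
        using less.IH[of p j] that less.prems Suc by (simp add: F_def)
      then show ?thesis
        by (simp add: lap_def algebra_simps scaleR_conv_of_real)
    qed
    have Fp: "F p m = \<phi> m * \<phi> p" "F (p - 1) m = \<phi> m * \<phi> (p - 1)"
      using less.IH[of p m] less.IH[of "p - 1" m] less.prems Suc by (auto simp: F_def)
    have "F (Suc p) m = F p m + (b' p *\<^sub>R (F p m - F (p - 1) m) + W p *\<^sub>R (lap (F p) m + q p *\<^sub>R F p m)) /\<^sub>R b p"
      unfolding lin[symmetric]
      by (simp add: F_def scaleR_sum_right scaleR_diff_left scaleR_add_left divide_inverse_commute
        sum_subtractf sum.distrib algebra_simps)
    \<comment> \<open>Here the eigenvalue disappears: \<open>\<phi> p * lap \<phi> m\<close> equals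
      \<open>\<phi> m * lap \<phi> p\<close>, both being
      \<open>- \<mu> * \<phi> m * \<phi> p\<close>.\<close>
    also have "\<dots> = \<phi> m * (\<phi> p + (b' p *\<^sub>R (\<phi> p - \<phi> (p - 1)) + W p *\<^sub>R (lap \<phi> p + q p *\<^sub>R \<phi> p)) /\<^sub>R b p)"
      unfolding lap_F Fp eigen by (simp add: algebra_simps scaleR_conv_of_real)
    also have "W p *\<^sub>R (lap \<phi> p + q p *\<^sub>R \<phi> p)
        = b p *\<^sub>R (\<phi> (Suc p) - \<phi> p) - b' p *\<^sub>R (\<phi> p - \<phi> (p - 1))"
      using W_pos[of p] by (simp add: lap_def)
    also have "\<phi> p + (b' p *\<^sub>R (\<phi> p - \<phi> (p - 1))
        + (b p *\<^sub>R (\<phi> (Suc p) - \<phi> p) - b' p *\<^sub>R (\<phi> p - \<phi> (p - 1)))) /\<^sub>R b p = \<phi> (Suc p)"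
      using b_pos[of p] by simp
    finally show ?thesis by (simp add: F_def Suc)
  qed
qed

text \<open>\<open>dmom l n\<close> is the discrete momentum
  \<open>b' n * (dsol l n - dsol l (n - 1))\<close>, the analogue of A v'; its start at 0 is the
  boundary condition on A v'. Keeping it as a second sequence makes the scheme comparable with the
  first-order system.\<close>

fun dsol dmom :: "complex \<Rightarrow> nat \<Rightarrow> complex" where
  "dsol l 0 = 1"
| "dmom l 0 = 0"
| "dsol l (Suc n) = dsol l n + (dmom l n + of_real (W n) * (of_real (q n) - l) * dsol l n) / of_real (b n)"
| "dmom l (Suc n) = dmom l n + of_real (W n) * (of_real (q n) - l) * dsol l n"

lemma dsol_eigenfunction: "lap (dsol l) n = - l * dsol l n"
proof -
  have right: "b n *\<^sub>R (dsol l (Suc n) - dsol l n) = dmom l (Suc n)" for n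
    using b_pos[of n] by (simp add: scaleR_conv_of_real)
  have left: "b' n *\<^sub>R (dsol l n - dsol l (n - 1)) = dmom l n"
    using right[of "n - 1"] by (cases n) (simp_all del: dsol.simps(2) dmom.simps(2))
  show ?thesis
    unfolding lap_def right left using W_pos[of n]
    by (simp add: scaleR_conv_of_real field_simps)
qed

text \<open>At eigenvalue 0 the momentum only accumulates nonnegative terms, so the solution
  increases from 1. The bound 1 does not depend on the mesh.\<close>

lemma dsol_ground_state: "\<exists>x\<ge>1. dsol 0 n = of_real x"
proof -
  have "\<exists>x y. dsol 0 n = of_real x \<and> dmom 0 n = of_real y \<and> x \<ge> 1 \<and> y \<ge> 0"
  proof (induction n)
    case 0
    then show ?case by (intro exI[of _ 1] exI[of _ 0]) simp
  next
    case (Suc n)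
    then obtain x y where xy: "dsol 0 n = of_real x" "dmom 0 n = of_real y" "x \<ge> 1" "y \<ge> 0"
      by blast
    have "W n * q n * x \<ge> 0" using W_pos[of n] q_nonneg[of n] xy by simp
    then show ?case
      using xy b_pos[of n]
      by (intro exI[of _ "x + (y + W n * q n * x) / b n"] exI[of _ "y + W n * q n * x"])
        (auto intro!: divide_nonneg_pos add_increasing2)
  qed
  then show ?thesis by blast
qed

text \<open>A Doob transform by the ground state. At \<open>l = 0\<close> all quotients are 1, so
  the formula itself yields the total mass of \<open>p\<close>.\<close>

lemma dsol_product_formula:
  assumes "n \<le> m"
  obtains p :: "nat \<Rightarrow> real" where "\<And>i. p i \<ge> 0" "(\<Sum>i\<le>m + n. p i) = 1"
    "\<And>l. (\<Sum>i\<le>m + n. p i *\<^sub>R (dsol l i / dsol 0 i)) = (dsol l m / dsol 0 m) * (dsol l n / dsol 0 n)"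
proof -
  define \<psi> where "\<psi> i = (SOME x. x \<ge> 1 \<and> dsol 0 i = of_real x)" for i
  have \<psi>: "\<psi> i \<ge> 1" "dsol 0 i = of_real (\<psi> i)" for i
    using someI_ex[of "\<lambda>x. x \<ge> 1 \<and> dsol 0 i = of_real x"] dsol_ground_state[of i]
    by (auto simp: \<psi>_def)
  have \<psi>_pos: "\<psi> i > 0" for i using \<psi>(1)[of i] by linarith
  define p where "p i = trans_kernel n m i * \<psi> i / (\<psi> m * \<psi> n)" for i
  have prod: "(\<Sum>i\<le>m + n. trans_kernel n m i *\<^sub>R dsol l i) = dsol l m * dsol l n" for l
    by (rule trans_kernel_mult[where \<mu> = l]) (simp_all add: dsol_eigenfunction)
  have eq: "(\<Sum>i\<le>m + n. p i *\<^sub>R (dsol l i / dsol 0 i)) = (dsol l m / dsol 0 m) * (dsol l n / dsol 0 n)" for l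
  proof -
    have "p i *\<^sub>R (dsol l i / dsol 0 i) = (trans_kernel n m i *\<^sub>R dsol l i) / of_real (\<psi> m * \<psi> n)" for i
      using \<psi>_pos[of i] by (simp add: p_def \<psi> scaleR_conv_of_real)
    then show ?thesis
      by (simp add: prod \<psi> flip: sum_divide_distrib)
  qed
  show ?thesis
  proof
    show "p i \<ge> 0" for i
      using trans_kernel_nonneg[OF assms, of i] \<psi>_pos by (simp add: p_def less_imp_le)
    have "complex_of_real (\<Sum>i\<le>m + n. p i) = 1"
      using eq[of 0] \<psi>_pos by (simp add: \<psi> scaleR_conv_of_real less_imp_neq[symmetric])
    then show "(\<Sum>i\<le>m + n. p i) = 1" by (simp only: of_real_eq_1_iff)
  qed (rule eq)
qed

end

section \<open>Linear differential equations with an integrable singularity at the origin\<close>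

lemma continuous_on_atLeast_iff:
  fixes f :: "real \<Rightarrow> 'a::topological_space"
  shows "continuous_on {0..} f \<longleftrightarrow> (\<forall>b>0. continuous_on {0..b} f)"
proof
  assume "\<forall>b>0. continuous_on {0..b} f"
  then show "continuous_on {0..} f"
    unfolding continuous_on_eq_continuous_within
  proof (intro ballI)
    fix x :: real assume H: "\<forall>b>0. \<forall>x\<in>{0..b}. continuous (at x within {0..b}) f" and x: "x \<in> {0..}"
    have "at x within {0..x + 1} = at x within {0..}"
      by (rule at_within_nhd[of _ "{..<x + 1}"]) auto
    then show "continuous (at x within {0..}) f"
      using H x by (metis add_nonneg_pos atLeastAtMost_iff atLeast_iff less_add_one order_less_imp_le zero_less_one)
  qed
qed (auto elim: continuous_on_subset)

text \<open>Integrability of \<open>g\<close> at 0 is encoded by a primitive \<open>S\<close> that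
  is continuous up to 0; the value \<open>g 0\<close> is left free.\<close>

locale singular_density =
  fixes g S :: "real \<Rightarrow> real"
  assumes g_cont: "continuous_on {0<..} g"
    and g_nonneg: "x > 0 \<Longrightarrow> g x \<ge> 0"
    and S_cont: "continuous_on {0..} S"
    and S_0 [simp]: "S 0 = 0"
    and S_deriv: "x > 0 \<Longrightarrow> (S has_real_derivative g x) (at x)"
begin

lemma S_mono:
  assumes "0 \<le> x" "x \<le> y"
  shows "S x \<le> S y"
proof (rule DERIV_nonneg_imp_increasing_open[OF assms(2)])
  show "\<exists>d. (S has_real_derivative d) (at t) \<and> 0 \<le> d" if "x < t" "t < y" for t
    using S_deriv[of t] g_nonneg[of t] that \<open>0 \<le> x\<close> by auto
  show "continuous_on {x..y} S"
    using S_cont by (rule continuous_on_subset) (use \<open>0 \<le> x\<close> in auto)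
qed

lemma S_nonneg: "0 \<le> x \<Longrightarrow> S x \<ge> 0"
  using S_mono[of 0 x] by simp

lemma g_abs_integrable: "g absolutely_integrable_on {0..b}"
proof (cases "b \<ge> 0")
  case True
  have "(g has_integral S b - S 0) {0..b}"
    by (rule fundamental_theorem_of_calculus_interior)
      (use True S_deriv continuous_on_subset[OF S_cont] in
        \<open>auto simp: has_real_derivative_iff_has_vector_derivative\<close>)
  then have "g integrable_on {0..b}" by (rule has_integral_integrable)
  \<comment> \<open>Absolute integrability is deduced from the sign of \<open>g\<close>, which is
    known only for positive arguments.\<close>
  then have "(\<lambda>x. if x = 0 then 0 else g x) integrable_on {0..b}"
    by (rule integrable_spike[where S = "{0}"]) auto
  then have "(\<lambda>x. if x = 0 then 0 else g x) absolutely_integrable_on {0..b}"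
    by (rule nonnegative_absolutely_integrable_1) (use g_nonneg in auto)
  then show ?thesis
    by (rule absolutely_integrable_spike[where S = "{0}"]) auto
qed auto

definition prim :: "(real \<Rightarrow> 'a::euclidean_space) \<Rightarrow> real \<Rightarrow> 'a" where
  "prim f x = integral {0..x} (\<lambda>t. g t *\<^sub>R f t)"

lemma prim_integrable:
  fixes f :: "real \<Rightarrow> 'a::euclidean_space"
  assumes "continuous_on {0..} f"
  shows "(\<lambda>t. g t *\<^sub>R f t) integrable_on {0..b}"
proof -
  have f: "continuous_on {0..b} f" using assms by (rule continuous_on_subset) auto
  have "(\<lambda>t. g t *\<^sub>R f t) absolutely_integrable_on {0..b}"
  proof (rule absolutely_integrable_bounded_measurable_product[where h = "\<lambda>z r. r *\<^sub>R z"])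
    show "bilinear (\<lambda>(z::'a) (r::real). r *\<^sub>R z)"
      by (simp add: bilinear_def linear_iff algebra_simps)
    show "f \<in> borel_measurable (lebesgue_on {0..b})"
      using f by (intro continuous_imp_measurable_on_sets_lebesgue) auto
    show "bounded (f ` {0..b})"
      using f by (intro compact_imp_bounded compact_continuous_image) auto
  qed (auto intro: g_abs_integrable)
  then show ?thesis by (simp add: absolutely_integrable_on_def)
qed

lemma prim_continuous:
  assumes "continuous_on {0..} f"
  shows "continuous_on {0..} (prim f)"
  unfolding continuous_on_atLeast_iff prim_def
  using indefinite_integral_continuous_1[OF prim_integrable[OF assms]] by blast

lemma prim_0 [simp]: "prim f 0 = 0"
  by (simp add: prim_def)

lemma prim_deriv:
  assumes f: "continuous_on {0..} f" and x: "x > 0"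
  shows "(prim f has_vector_derivative g x *\<^sub>R f x) (at x)"
proof -
  have "continuous_on {0<..} (\<lambda>t. g t *\<^sub>R f t)"
    by (intro continuous_intros g_cont continuous_on_subset[OF f]) auto
  then have "continuous (at x) (\<lambda>t. g t *\<^sub>R f t)"
    using x by (simp add: continuous_on_eq_continuous_at)
  \<comment> \<open>The empty set is the exceptional set in
    \<open>integral_has_vector_derivative_continuous_at\<close>; the interval reaches beyond
    \<open>x\<close> so that the derivative becomes two-sided.\<close>
  then have "continuous (at x within {0..x + 1} - {}) (\<lambda>t. g t *\<^sub>R f t)"
    by (rule continuous_at_imp_continuous_at_within)
  then have "(prim f has_vector_derivative g x *\<^sub>R f x) (at x within {0..x + 1} - {})"
    unfolding prim_def
    by (intro integral_has_vector_derivative_continuous_at prim_integrable f) (use x in auto)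
  moreover have "at x within {0..x + 1} - {} = at x"
    using x by (intro at_within_interior) simp
  ultimately show ?thesis by simp
qed

lemma prim_diff:
  assumes "continuous_on {0..} f" "continuous_on {0..} h"
  shows "prim (\<lambda>t. f t - h t) x = prim f x - prim h x"
  unfolding prim_def scaleR_diff_right
  by (intro integral_diff prim_integrable assms)

lemma norm_prim_le:
  assumes f: "continuous_on {0..} f" and x: "x \<ge> 0"
    and \<Phi>: "continuous_on {0..x} \<Phi>" "\<And>t. 0 < t \<Longrightarrow> t < x \<Longrightarrow> (\<Phi> has_real_derivative \<Phi>' t) (at t)"
    and le: "\<And>t. 0 < t \<Longrightarrow> t < x \<Longrightarrow> g t * norm (f t) \<le> \<Phi>' t"
  shows "norm (prim f x) \<le> \<Phi> x - \<Phi> 0"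
proof (cases "x = 0")
  case False
  with x have "0 < x" by simp
  then have "norm (prim f x - prim f 0) \<le> \<Phi> x - \<Phi> 0"
    by (rule differentiable_bound_general)
      (use \<Phi> le g_nonneg f in \<open>auto intro: prim_deriv continuous_on_subset[OF prim_continuous]
        simp flip: has_real_derivative_iff_has_vector_derivative\<close>)
  then show ?thesis by simp
qed simp

text \<open>Picard iteration with \<open>S\<close> as time: successive differences are bounded by
  \<open>norm z0 * (K * S x) ^ n / fact n\<close>, so a pole of \<open>g\<close> at 0 does no
  harm.\<close>

theorem linear_ode_exists:
  fixes N :: "real \<Rightarrow> 'a::euclidean_space \<Rightarrow> 'a"
  assumes N_diff: "\<And>x y z. N x (y - z) = N x y - N x z"
    and N_cont: "\<And>f. continuous_on {0..} f \<Longrightarrow> continuous_on {0..} (\<lambda>x. N x (f x))"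
    and N_bound: "\<And>b. \<exists>K\<ge>0. \<forall>x\<in>{0..b}. \<forall>z. norm (N x z) \<le> K * norm z"
  obtains z where "continuous_on {0..} z" "z 0 = z0"
    "\<And>x. x > 0 \<Longrightarrow> (z has_vector_derivative g x *\<^sub>R N x (z x)) (at x)"
proof -
  define zs where "zs = rec_nat (\<lambda>x. z0) (\<lambda>n f x. z0 + prim (\<lambda>t. N t (f t)) x)"
  have zs_0: "zs 0 = (\<lambda>x. z0)" and zs_Suc: "zs (Suc n) = (\<lambda>x. z0 + prim (\<lambda>t. N t (zs n t)) x)" for n
    by (simp_all add: zs_def)
  have zs_cont: "continuous_on {0..} (zs n)" for n
    by (induction n) (auto simp: zs_0 zs_Suc intro!: continuous_intros prim_continuous N_cont)
  have step: "norm (zs (Suc n) x - zs n x) \<le> norm z0 * (K * S x) ^ Suc n / fact (Suc n)"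
    if K: "K \<ge> 0" "\<forall>x\<in>{0..b}. \<forall>z. norm (N x z) \<le> K * norm z" and x: "x \<in> {0..b}" for K b x n
    using x
  proof (induction n arbitrary: x)
    case 0
    have "norm (prim (\<lambda>t. N t (zs 0 t)) x) \<le> norm z0 * K * S x - norm z0 * K * S 0"
    proof (rule norm_prim_le[where \<Phi>' = "\<lambda>t. norm z0 * K * g t"])
      show "continuous_on {0..} (\<lambda>t. N t (zs 0 t))" by (intro N_cont zs_cont)
      show "continuous_on {0..x} (\<lambda>x. norm z0 * K * S x)"
        by (intro continuous_intros continuous_on_subset[OF S_cont]) auto
      fix t assume t: "0 < t" "t < x"
      show "((\<lambda>x. norm z0 * K * S x) has_real_derivative norm z0 * K * g t) (at t)"
        using t by (intro DERIV_cmult S_deriv)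
      have "norm (N t (zs 0 t)) \<le> K * norm z0"
        using K t 0 by (simp add: zs_0)
      then show "g t * norm (N t (zs 0 t)) \<le> norm z0 * K * g t"
        using g_nonneg[OF t(1)] mult_left_mono[of "norm (N t (zs 0 t))" "K * norm z0" "g t"]
        by (simp add: mult_ac)
    qed (use 0 in auto)
    then show ?case by (simp add: zs_Suc) (simp add: zs_0 mult_ac)
  next
    case (Suc n)
    define \<Phi> where "\<Phi> t = norm z0 * (K * S t) ^ Suc (Suc n) / fact (Suc (Suc n))" for t
    define \<Phi>' where "\<Phi>' t = norm z0 * (K * S t) ^ Suc n / fact (Suc n) * K * g t" for t
    have cont: "continuous_on {0..} (\<lambda>t. N t (zs (Suc n) t - zs n t))"
      by (intro N_cont continuous_intros zs_cont)
    have "norm (prim (\<lambda>t. N t (zs (Suc n) t - zs n t)) x) \<le> \<Phi> x - \<Phi> 0"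
    proof (rule norm_prim_le[where \<Phi>' = \<Phi>', OF cont])
      show "continuous_on {0..x} \<Phi>"
        unfolding \<Phi>_def by (intro continuous_intros continuous_on_subset[OF S_cont]) auto
      fix t assume t: "0 < t" "t < x"
      have "((\<lambda>t. norm z0 * (K * S t) ^ Suc (Suc n) / fact (Suc (Suc n))) has_real_derivative
          norm z0 * (real (Suc (Suc n)) * (K * g t * (K * S t) ^ (Suc (Suc n) - Suc 0))) / fact (Suc (Suc n))) (at t)"
        using t by (intro DERIV_cdivide DERIV_cmult DERIV_power S_deriv)
      moreover have "norm z0 * (real (Suc (Suc n)) * (K * g t * (K * S t) ^ (Suc (Suc n) - Suc 0))) / fact (Suc (Suc n)) = \<Phi>' t"
        unfolding \<Phi>'_def fact_Suc[of "Suc n"]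
        by (simp add: mult_ac del: of_nat_Suc fact_Suc power_Suc)
      ultimately show "(\<Phi> has_real_derivative \<Phi>' t) (at t)" by (simp only: \<Phi>_def[abs_def])
      have "norm (N t (zs (Suc n) t - zs n t)) \<le> K * norm (zs (Suc n) t - zs n t)"
        using K t Suc.prems by auto
      also have "\<dots> \<le> K * (norm z0 * (K * S t) ^ Suc n / fact (Suc n))"
        by (intro mult_left_mono Suc.IH) (use K t Suc.prems in auto)
      finally have "g t * norm (N t (zs (Suc n) t - zs n t))
          \<le> g t * (K * (norm z0 * (K * S t) ^ Suc n / fact (Suc n)))"
        by (intro mult_left_mono) (use g_nonneg t in auto)
      also have "\<dots> = \<Phi>' t" by (simp add: \<Phi>'_def)
      finally show "g t * norm (N t (zs (Suc n) t - zs n t)) \<le> \<Phi>' t" .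
    qed (use Suc.prems in auto)
    moreover have "prim (\<lambda>t. N t (zs (Suc n) t - zs n t)) x = zs (Suc (Suc n)) x - zs (Suc n) x"
      using prim_diff[OF N_cont[OF zs_cont] N_cont[OF zs_cont], of "Suc n" n x]
      by (simp add: zs_Suc N_diff)
    ultimately show ?case by (simp add: \<Phi>_def)
  qed
  define z where "z x = z0 + (\<Sum>n. zs (Suc n) x - zs n x)" for x
  have unif: "uniform_limit {0..b} zs z sequentially" if "b > 0" for b
  proof -
    obtain K where K: "K \<ge> 0" "\<forall>x\<in>{0..b}. \<forall>z. norm (N x z) \<le> K * norm z"
      using N_bound by blast
    have "uniform_limit {0..b} (\<lambda>n x. \<Sum>i<n. zs (Suc i) x - zs i x) (\<lambda>x. \<Sum>n. zs (Suc n) x - zs n x) sequentially"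
    proof (rule Weierstrass_m_test)
      show "norm (zs (Suc n) x - zs n x) \<le> norm z0 * ((K * S b) ^ Suc n / fact (Suc n))" if "x \<in> {0..b}" for n x
      proof -
        have "norm (zs (Suc n) x - zs n x) \<le> norm z0 * ((K * S x) ^ Suc n / fact (Suc n))"
          using step[OF K that, of n] by simp
        also have "\<dots> \<le> norm z0 * ((K * S b) ^ Suc n / fact (Suc n))"
          by (intro mult_left_mono divide_right_mono power_mono S_mono)
            (use that K S_nonneg in auto)
        finally show ?thesis .
      qed
      have "summable (\<lambda>n. (K * S b) ^ n / fact n)"
        using summable_exp[of "K * S b"] by (simp add: divide_inverse mult.commute)
      then show "summable (\<lambda>n. norm z0 * ((K * S b) ^ Suc n / fact (Suc n)))"
        by (subst summable_Suc_iff[of "\<lambda>n. norm z0 * ((K * S b) ^ n / fact n)"]) (rule summable_mult)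
    qed
    then have "uniform_limit {0..b} (\<lambda>n x. z0 + (\<Sum>i<n. zs (Suc i) x - zs i x)) z sequentially"
      unfolding z_def by (intro uniform_limit_add uniform_limit_const)
    moreover have "z0 + (\<Sum>i<n. zs (Suc i) x - zs i x) = zs n x" for n x
      using sum_lessThan_telescope[of "\<lambda>i. zs i x" n] by (simp add: zs_0)
    ultimately show ?thesis by simp
  qed
  have z_cont: "continuous_on {0..} z"
    unfolding continuous_on_atLeast_iff
  proof safe
    fix b :: real assume "b > 0"
    show "continuous_on {0..b} z"
      by (rule uniform_limit_theorem[OF _ unif[OF \<open>b > 0\<close>]])
        (auto intro!: eventuallyI continuous_on_subset[OF zs_cont])
  qed
  have z_eq: "z x = z0 + prim (\<lambda>t. N t (z t)) x" if x: "x > 0" for x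
  proof -
    obtain K where K: "K \<ge> 0" "\<forall>y\<in>{0..x}. \<forall>z. norm (N y z) \<le> K * norm z"
      using N_bound by blast
    have "(\<lambda>n. zs (Suc n) x) \<longlonglongrightarrow> z0 + prim (\<lambda>t. N t (z t)) x"
    proof (rule LIMSEQ_I)
      fix e :: real assume e: "e > 0"
      \<comment> \<open>The limit in the integral equation costs \<open>K * \<eta> * S x\<close>;
        the summand 1 keeps the quotient defined when \<open>K * S x = 0\<close>.\<close>
      define \<eta> where "\<eta> = e / (K * S x + 1)"
      have KS: "K * S x \<ge> 0" using K S_nonneg[of x] x by simp
      have "\<eta> > 0" using e KS by (simp add: \<eta>_def)
      then have "\<forall>\<^sub>F n in sequentially. \<forall>t\<in>{0..x}. dist (zs n t) (z t) < \<eta>"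
        using unif[OF x] by (simp add: uniform_limit_iff)
      then obtain n0 where n0: "\<And>n t. n \<ge> n0 \<Longrightarrow> t \<in> {0..x} \<Longrightarrow> norm (zs n t - z t) < \<eta>"
        unfolding eventually_sequentially dist_norm by blast
      show "\<exists>n0. \<forall>n\<ge>n0. norm (zs (Suc n) x - (z0 + prim (\<lambda>t. N t (z t)) x)) < e"
      proof (intro exI allI impI)
        fix n assume n: "n \<ge> n0"
        have cont: "continuous_on {0..} (\<lambda>t. N t (zs n t - z t))"
          by (intro N_cont continuous_intros zs_cont z_cont)
        have "norm (prim (\<lambda>t. N t (zs n t - z t)) x) \<le> K * \<eta> * S x - K * \<eta> * S 0"
        proof (rule norm_prim_le[where \<Phi>' = "\<lambda>t. K * \<eta> * g t", OF cont])
          show "continuous_on {0..x} (\<lambda>x. K * \<eta> * S x)"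
            by (intro continuous_intros continuous_on_subset[OF S_cont]) auto
          fix t assume t: "0 < t" "t < x"
          show "((\<lambda>x. K * \<eta> * S x) has_real_derivative K * \<eta> * g t) (at t)"
            using t by (intro DERIV_cmult S_deriv)
          have "norm (N t (zs n t - z t)) \<le> K * norm (zs n t - z t)"
            using K t by auto
          also have "\<dots> \<le> K * \<eta>"
            by (intro mult_left_mono less_imp_le[OF n0]) (use K t n in auto)
          finally show "g t * norm (N t (zs n t - z t)) \<le> K * \<eta> * g t"
            using g_nonneg[OF t(1)] by (simp add: mult.commute mult_left_mono)
        qed (use x in auto)
        also have "K * \<eta> * S x - K * \<eta> * S 0 = e * (K * S x / (K * S x + 1))"
          by (simp add: \<eta>_def)
        also have "\<dots> < e * 1"
          using e KS by (intro mult_strict_left_mono) auto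
        also have "prim (\<lambda>t. N t (zs n t - z t)) x = zs (Suc n) x - (z0 + prim (\<lambda>t. N t (z t)) x)"
          unfolding N_diff by (subst prim_diff) (auto intro: N_cont zs_cont z_cont simp: zs_Suc)
        finally show "norm (zs (Suc n) x - (z0 + prim (\<lambda>t. N t (z t)) x)) < e" by simp
      qed
    qed
    moreover have "(\<lambda>n. zs (Suc n) x) \<longlonglongrightarrow> z x"
      using tendsto_uniform_limitI[OF unif[OF x], of x] x by (intro LIMSEQ_Suc) auto
    ultimately show ?thesis using LIMSEQ_unique by blast
  qed
  show ?thesis
  proof
    show "continuous_on {0..} z" by fact
    have "zs n 0 = z0" for n by (cases n) (simp_all add: zs_0 zs_Suc)
    then show "z 0 = z0" by (simp add: z_def)
    show "(z has_vector_derivative g x *\<^sub>R N x (z x)) (at x)" if x: "x > 0" for x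
    proof (rule has_vector_derivative_transform_within_open[where S = "{0<..}"])
      show "((\<lambda>x. z0 + prim (\<lambda>t. N t (z t)) x) has_vector_derivative g x *\<^sub>R N x (z x)) (at x)"
        using prim_deriv[OF N_cont[OF z_cont] x] by (auto intro!: derivative_eq_intros)
    qed (use x z_eq in auto)
  qed
qed

text \<open>The energy \<open>E\<close>, the squared norm damped by
  \<open>exp (- 2 * K * S t)\<close>, starts at 0 and cannot increase.\<close>

theorem linear_ode_unique:
  fixes N :: "real \<Rightarrow> 'a::real_inner \<Rightarrow> 'a"
  assumes N_bound: "\<And>b. \<exists>K\<ge>0. \<forall>x\<in>{0..b}. \<forall>z. norm (N x z) \<le> K * norm z"
    and z: "continuous_on {0..} z" "z 0 = 0"
    and z': "\<And>x. x > 0 \<Longrightarrow> (z has_vector_derivative g x *\<^sub>R N x (z x)) (at x)"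
    and x: "x \<ge> 0"
  shows "z x = 0"
proof -
  obtain K where K: "K \<ge> 0" "\<forall>y\<in>{0..x}. \<forall>z. norm (N y z) \<le> K * norm z"
    using N_bound by blast
  define E where "E t = (z t \<bullet> z t) * exp (- 2 * K * S t)" for t
  have "E 0 \<ge> E x"
  proof (rule DERIV_nonpos_imp_decreasing_open[OF x])
    show "continuous_on {0..x} E"
      unfolding E_def
      by (intro continuous_intros continuous_on_subset[OF S_cont] continuous_on_subset[OF z(1)]) auto
    fix t assume t: "0 < t" "t < x"
    have zt: "((\<lambda>t. z t \<bullet> z t) has_real_derivative (2 * g t * (z t \<bullet> N t (z t)))) (at t)"
      using bounded_bilinear.has_vector_derivative[OF bounded_bilinear_inner z'[OF t(1)] z'[OF t(1)]]
      by (simp add: has_real_derivative_iff_has_vector_derivative inner_commute mult.assoc)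
    have "(E has_real_derivative 2 * g t * exp (- 2 * K * S t) * (z t \<bullet> N t (z t) - K * (z t \<bullet> z t))) (at t)"
      unfolding E_def by (rule derivative_eq_intros zt S_deriv t refl | simp add: algebra_simps)+
    moreover have "z t \<bullet> N t (z t) \<le> K * (z t \<bullet> z t)"
    proof -
      have "z t \<bullet> N t (z t) \<le> norm (z t) * norm (N t (z t))"
        by (rule norm_cauchy_schwarz)
      also have "\<dots> \<le> norm (z t) * (K * norm (z t))"
        by (intro mult_left_mono) (use K t in auto)
      finally show ?thesis by (simp add: dot_square_norm power2_eq_square algebra_simps)
    qed
    ultimately show "\<exists>y. (E has_real_derivative y) (at t) \<and> y \<le> 0"
      using g_nonneg[OF t(1)] by (auto intro!: exI mult_nonneg_nonpos)
  qed
  then have "z x \<bullet> z x \<le> 0"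
    using z(2) by (simp add: E_def mult_le_0_iff)
  then show ?thesis by (metis inner_gt_zero_iff not_le)
qed

end

section \<open>The radial equation\<close>

locale cone_profile =
  fixes A S :: "real \<Rightarrow> real" and k :: int
  assumes A_cont: "continuous_on {0..} A"
    and A_diff: "\<And>x. x > 0 \<Longrightarrow> A differentiable (at x)"
    and A_pos: "\<And>x. x > 0 \<Longrightarrow> A x > 0"
    and A_log_nonneg: "\<And>x. x > 0 \<Longrightarrow> deriv A x / A x \<ge> 0"
    and A_log_decr: "antimono_on {0<..} (\<lambda>x. deriv A x / A x)"
    and S_cont': "continuous_on {0..} S"
    and S_0': "S 0 = 0"
    and S_deriv': "\<And>x. x > 0 \<Longrightarrow> (S has_real_derivative 1 / A x) (at x)"
begin

sublocale singular_density "\<lambda>x. 1 / A x" S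
proof
  show "continuous_on {0<..} (\<lambda>x. 1 / A x)"
    by (intro continuous_intros continuous_on_subset[OF A_cont]) (use A_pos in \<open>force+\<close>)
qed (use A_pos S_cont' S_0' S_deriv' in \<open>auto intro: less_imp_le\<close>)

definition c :: real where "c = 2 * of_int k * pi"

lemma A_deriv: "x > 0 \<Longrightarrow> (A has_real_derivative deriv A x) (at x)"
  using A_diff[of x] by (simp add: DERIV_deriv_iff_real_differentiable)

lemma A_mono:
  assumes "0 \<le> x" "x \<le> y"
  shows "A x \<le> A y"
proof (rule DERIV_nonneg_imp_increasing_open[OF assms(2)])
  show "\<exists>d. (A has_real_derivative d) (at t) \<and> 0 \<le> d" if "x < t" "t < y" for t
    using A_deriv[of t] A_log_nonneg[of t] A_pos[of t] that assms
    by (intro exI[of _ "deriv A t"]) (auto simp: zero_le_divide_iff)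
  show "continuous_on {x..y} A"
    using A_cont by (rule continuous_on_subset) (use assms in auto)
qed

lemma A_nonneg: "0 \<le> x \<Longrightarrow> A x \<ge> 0"
proof (rule ccontr)
  assume "0 \<le> x" "\<not> A x \<ge> 0"
  then have "x = 0" "A 0 < 0" using A_pos[of x] by (cases "x = 0"; force)+
  have "continuous (at_right 0) A"
    using A_cont by (auto simp: continuous_on_eq_continuous_within intro: continuous_within_subset)
  then have "\<forall>\<^sub>F x in at_right 0. A x < 0"
    using \<open>A 0 < 0\<close> by (auto simp: continuous_within intro: order_tendstoD)
  moreover have "\<forall>\<^sub>F x in at_right 0. A x > 0"
    using A_pos by (auto simp: eventually_at_right_field intro: exI[of _ 1])
  ultimately have "\<forall>\<^sub>F x::real in at_right 0. False"
    by eventually_elim simp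
  then show False by simp
qed

section \<open>Log-concavity of A and its inheritance by the grid\<close>

text \<open>The logarithmic derivative of \<open>A (t + h) / A t\<close> is the difference of A'/A
  at \<open>t + h\<close> and at \<open>t\<close>, which is not positive.\<close>

lemma A_shift_ratio:
  assumes "0 < y" "y \<le> z" "h > 0"
  shows "A y * A (z + h) \<le> A (y + h) * A z"
proof -
  have "A (z + h) / A z \<le> A (y + h) / A y"
  proof (rule DERIV_nonpos_imp_nonincreasing[OF assms(2)])
    fix t assume "y \<le> t" "t \<le> z"
    then have t: "t > 0" "t + h > 0" using assms by auto
    have "((\<lambda>t. A (t + h) / A t) has_real_derivative
        (deriv A (t + h) * A t - A (t + h) * deriv A t) / (A t * A t)) (at t)"
      using A_deriv[OF t(2)] A_deriv[OF t(1)] A_pos[OF t(1)]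
      by (intro DERIV_divide) (simp_all add: DERIV_shift)
    moreover have "deriv A (t + h) / A (t + h) \<le> deriv A t / A t"
      using A_log_decr t assms(3) by (auto simp: monotone_on_def)
    then have "deriv A (t + h) * A t - A (t + h) * deriv A t \<le> 0"
      using A_pos[OF t(1)] A_pos[OF t(2)] by (simp add: field_simps)
    ultimately show "\<exists>y. ((\<lambda>t. A (t + h) / A t) has_real_derivative y) (at t) \<and> y \<le> 0"
      by (auto intro!: exI divide_nonpos_nonneg)
  qed
  then show ?thesis using A_pos assms by (simp add: field_simps)
qed

text \<open>The grid is uniform in \<open>x\<close>, but increments of \<open>S\<close> serve as the resistances \<open>1 / b n\<close>: they absorb the
  possible singularity of \<open>1/A\<close> at \<open>0\<close> and inherit log-convexity from \<open>1/A\<close>.\<close>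

definition \<delta> :: "real \<Rightarrow> nat \<Rightarrow> real" where
  "\<delta> h n = S (real (Suc n) * h) - S (real n * h)"

lemma \<delta>_mvt:
  assumes "h > 0"
  obtains \<xi> where "real n * h < \<xi>" "\<xi> < real (Suc n) * h" "\<delta> h n = h / A \<xi>"
proof -
  have lt: "real n * h < real (Suc n) * h" using assms by simp
  have "continuous_on {real n * h..real (Suc n) * h} S"
    using S_cont by (rule continuous_on_subset) (use assms in \<open>auto intro: order_trans[rotated]\<close>)
  moreover have "S differentiable (at t)" if "real n * h < t" for t
  proof -
    have "0 < t" using assms that by (smt (verit) mult_nonneg_nonneg of_nat_0_le_iff)
    then show ?thesis using S_deriv[of t] by (auto simp: real_differentiable_def)
  qed
  ultimately obtain l \<xi> where \<xi>: "real n * h < \<xi>" "\<xi> < real (Suc n) * h" "DERIV S \<xi> :> l"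
      "S (real (Suc n) * h) - S (real n * h) = (real (Suc n) * h - real n * h) * l"
    using MVT[OF lt, of S] by blast
  then have "\<xi> > 0" using assms by (smt (verit) mult_nonneg_nonneg of_nat_0_le_iff)
  then have "l = 1 / A \<xi>" using S_deriv DERIV_unique \<xi>(3) by blast
  then show ?thesis using that \<xi> by (simp add: \<delta>_def algebra_simps)
qed

text \<open>Cauchy's mean value theorem for \<open>S (t + h)\<close> and \<open>S t\<close>: one
  point \<open>\<xi>\<close> serves both increments, whereas two separate mean values would give
  unrelated points.\<close>

lemma \<delta>_ratio:
  assumes "h > 0"
  obtains \<xi> where "real n * h < \<xi>" "\<xi> < real (Suc n) * h" "\<delta> h (Suc n) * A (\<xi> + h) = \<delta> h n * A \<xi>"
proof -
  have lt: "real n * h < real (Suc n) * h" using assms by simp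
  have pos: "t > 0" if "real n * h < t" for t
    using assms that by (smt (verit) mult_nonneg_nonneg of_nat_0_le_iff)
  have ge: "t \<ge> 0" if "real n * h \<le> t" for t
    using assms that by (smt (verit) mult_nonneg_nonneg of_nat_0_le_iff)
  have S': "((\<lambda>t. S (t + h)) has_real_derivative 1 / A (t + h)) (at t)" if "t + h > 0" for t
    using S_deriv[OF that] by (simp add: DERIV_shift)
  have S'': "(S has_real_derivative 1 / A t) (at t)" "((\<lambda>t. S (t + h)) has_real_derivative 1 / A (t + h)) (at t)"
    if "real n * h < t" for t
    using pos[OF that] assms by (auto intro: S_deriv S')
  define \<Phi> where "\<Phi> t = S (t + h) * \<delta> h n - S t * \<delta> h (Suc n)" for t
  have \<Phi>': "(\<Phi> has_real_derivative 1 / A (t + h) * \<delta> h n - 1 / A t * \<delta> h (Suc n)) (at t)"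
    if "real n * h < t" for t
    unfolding \<Phi>_def by (intro DERIV_diff DERIV_cmult_right S'' that)
  have "continuous_on {real n * h..real (Suc n) * h} (\<lambda>t. S (t + h))"
    by (intro continuous_on_compose2[OF S_cont] continuous_intros) (use ge assms in \<open>auto intro: add_nonneg_nonneg\<close>)
  moreover have "continuous_on {real n * h..real (Suc n) * h} S"
    using S_cont by (rule continuous_on_subset) (use ge in auto)
  ultimately have "continuous_on {real n * h..real (Suc n) * h} \<Phi>"
    unfolding \<Phi>_def by (intro continuous_intros)
  moreover have "\<Phi> differentiable (at t)" if "real n * h < t" for t
    using \<Phi>'[OF that] by (auto simp: real_differentiable_def)
  ultimately obtain l \<xi> where \<xi>: "real n * h < \<xi>" "\<xi> < real (Suc n) * h" "DERIV \<Phi> \<xi> :> l"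
      "\<Phi> (real (Suc n) * h) - \<Phi> (real n * h) = (real (Suc n) * h - real n * h) * l"
    using MVT[OF lt, of \<Phi>] by blast
  have "\<Phi> (real (Suc n) * h) - \<Phi> (real n * h) = 0"
    by (simp add: \<Phi>_def \<delta>_def algebra_simps)
  then have "l = 0" using \<xi>(4) assms by (simp add: algebra_simps)
  then have eq: "\<delta> h (Suc n) / A \<xi> = \<delta> h n / A (\<xi> + h)"
    using DERIV_unique[OF \<Phi>'[OF \<xi>(1)] \<xi>(3)] by simp
  have "A \<xi> > 0" "A (\<xi> + h) > 0" using pos[OF \<xi>(1)] assms by (auto intro!: A_pos)
  then show ?thesis using that \<xi> eq by (simp add: field_simps)
qed

lemma \<delta>_pos: "h > 0 \<Longrightarrow> \<delta> h n > 0"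
proof -
  assume h: "h > 0"
  obtain \<xi> where "real n * h < \<xi>" "\<delta> h n = h / A \<xi>" using \<delta>_mvt[OF h] by metis
  moreover then have "\<xi> > 0" using h by (smt (verit) mult_nonneg_nonneg of_nat_0_le_iff)
  ultimately show ?thesis using h A_pos[of \<xi>] by simp
qed

text \<open>The ratio of consecutive increments is \<open>A x / A (x + h)\<close> for some
  \<open>x\<close> in the corresponding cell. For \<open>i < j\<close> the cells are ordered, hence
  so are the points, and \<open>A_shift_ratio\<close> compares the ratios.\<close>

lemma \<delta>_log_convex:
  assumes h: "h > 0" and "i \<le> j"
  shows "\<delta> h (Suc i) * \<delta> h j \<le> \<delta> h i * \<delta> h (Suc j)"
proof (cases "i = j")
  case False
  with assms have "Suc i \<le> j" by simp
  obtain x where x: "real i * h < x" "x < real (Suc i) * h" "\<delta> h (Suc i) * A (x + h) = \<delta> h i * A x"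
    using \<delta>_ratio[OF h] by metis
  obtain y where y: "real j * h < y" "y < real (Suc j) * h" "\<delta> h (Suc j) * A (y + h) = \<delta> h j * A y"
    using \<delta>_ratio[OF h] by metis
  have "real (Suc i) * h \<le> real j * h" using \<open>Suc i \<le> j\<close> h by (intro mult_right_mono) auto
  then have xy: "x \<le> y" using x y by linarith
  have "x > 0" using x h by (smt (verit) mult_nonneg_nonneg of_nat_0_le_iff)
  with xy h have pos: "A x > 0" "A y > 0" "A (x + h) > 0" "A (y + h) > 0" by (auto intro!: A_pos)
  have "\<delta> h (Suc i) = \<delta> h i * (A x / A (x + h))" "\<delta> h (Suc j) = \<delta> h j * (A y / A (y + h))"
    using x(3) y(3) pos by (auto simp: field_simps)
  moreover have "A x / A (x + h) \<le> A y / A (y + h)"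
    using A_shift_ratio[OF \<open>x > 0\<close> xy h] pos by (simp add: field_simps)
  then have "(\<delta> h i * \<delta> h j) * (A x / A (x + h)) \<le> (\<delta> h i * \<delta> h j) * (A y / A (y + h))"
    by (intro mult_left_mono) (use \<delta>_pos[OF h] in \<open>auto intro: less_imp_le\<close>)
  ultimately show ?thesis by (simp add: mult_ac)
qed simp

lemma \<delta>_antimono:
  assumes h: "h > 0" and "i \<le> j"
  shows "\<delta> h j \<le> \<delta> h i"
proof (rule lift_Suc_antimono_le[OF _ \<open>i \<le> j\<close>])
  fix n
  obtain \<xi> where \<xi>: "real n * h < \<xi>" "\<delta> h (Suc n) * A (\<xi> + h) = \<delta> h n * A \<xi>"
    using \<delta>_ratio[OF h] by metis
  then have "\<xi> > 0" using h by (smt (verit) mult_nonneg_nonneg of_nat_0_le_iff)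
  then have "\<delta> h (Suc n) * A (\<xi> + h) \<le> \<delta> h n * A (\<xi> + h)"
    unfolding \<xi> using h \<delta>_pos[OF h, of n] by (intro mult_left_mono A_mono) auto
  then show "\<delta> h (Suc n) \<le> \<delta> h n"
    using A_pos[of "\<xi> + h"] \<open>\<xi> > 0\<close> h by simp
qed

text \<open>The potential is built from \<open>\<delta> h n\<close> and not from
  \<open>h / A (n * h)\<close>: it stays meaningful at \<open>n = 0\<close>, where A may vanish, and
  it inherits monotonicity from the increments.\<close>

lemma discretization:
  assumes h: "h > 0"
  shows "discrete_sturm_liouville (\<lambda>n. 1 / \<delta> h n) (\<lambda>n. c\<^sup>2 * (\<delta> h n)\<^sup>2 / 2)"
proof
  show "1 / \<delta> h i * (1 / \<delta> h (Suc j)) \<le> 1 / \<delta> h (Suc i) * (1 / \<delta> h j)" if "i \<le> j" for i j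
    using \<delta>_log_convex[OF h that] \<delta>_pos[OF h] by (simp add: field_simps)
  show "1 / \<delta> h i \<le> 1 / \<delta> h j" if "i \<le> j" for i j
    using \<delta>_antimono[OF h that] \<delta>_pos[OF h] by (simp add: field_simps)
  show "c\<^sup>2 * (\<delta> h j)\<^sup>2 / 2 \<le> c\<^sup>2 * (\<delta> h i)\<^sup>2 / 2" if "i \<le> j" for i j
    using \<delta>_antimono[OF h that] \<delta>_pos[OF h, of j]
    by (intro divide_right_mono mult_left_mono power_mono) auto
qed (use \<delta>_pos[OF h] in auto)

section \<open>The radial equation as a first-order system\<close>

text \<open>With \<open>S\<close> as time the radial equation reads d^2 v / dS^2 =
  \<open>pot lam\<close> v.\<close>

definition pot :: "complex \<Rightarrow> real \<Rightarrow> complex" where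
  "pot lam x = of_real (c\<^sup>2) - lam * of_real ((A x)\<^sup>2)"

lemma pot_continuous: "continuous_on {0..} (pot lam)"
  unfolding pot_def by (intro continuous_intros A_cont)

text \<open>The first-order form of the radial equation in the pair \<open>v\<close> and \<open>P = A v'\<close>.\<close>

definition is_sol :: "complex \<Rightarrow> (real \<Rightarrow> complex) \<Rightarrow> (real \<Rightarrow> complex) \<Rightarrow> bool" where
  "is_sol lam v P \<longleftrightarrow> continuous_on {0..} v \<and> continuous_on {0..} P \<and> v 0 = 1 \<and> P 0 = 0 \<and>
    (\<forall>x>0. (v has_vector_derivative (1 / A x) *\<^sub>R P x) (at x) \<and>
      (P has_vector_derivative (1 / A x) *\<^sub>R (pot lam x * v x)) (at x))"

definition sys :: "complex \<Rightarrow> real \<Rightarrow> complex \<times> complex \<Rightarrow> complex \<times> complex" where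
  "sys lam x z = (snd z, pot lam x * fst z)"

lemma sys_bound: "\<exists>K\<ge>0. \<forall>x\<in>{0..b}. \<forall>z. norm (sys lam x z) \<le> K * norm z"
proof (intro exI conjI ballI allI)
  fix x z assume x: "x \<in> {0..b}"
  have "norm (sys lam x z) \<le> norm (snd z) + norm (pot lam x * fst z)"
    unfolding sys_def by (rule norm_Pair_le)
  also have "\<dots> \<le> norm z + (c\<^sup>2 + norm lam * (A b)\<^sup>2) * norm z"
  proof (rule add_mono)
    show "norm (snd z) \<le> norm z" using norm_snd_le[where x = "fst z" and y = "snd z"] by simp
    have "norm (pot lam x) \<le> c\<^sup>2 + norm lam * (A x)\<^sup>2"
      unfolding pot_def by (rule norm_triangle_le_diff) (simp add: norm_mult norm_power)
    also have "\<dots> \<le> c\<^sup>2 + norm lam * (A b)\<^sup>2"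
      using A_mono[of x b] A_nonneg[of x] x by (intro add_left_mono mult_left_mono power_mono) auto
    finally show "norm (pot lam x * fst z) \<le> (c\<^sup>2 + norm lam * (A b)\<^sup>2) * norm z"
      unfolding norm_mult
      using norm_fst_le[where x = "fst z" and y = "snd z"] by (intro mult_mono) auto
  qed
  finally show "norm (sys lam x z) \<le> (1 + (c\<^sup>2 + norm lam * (A b)\<^sup>2)) * norm z"
    by (simp add: algebra_simps)
qed simp

lemma is_sol_iff_sys:
  "is_sol lam v P \<longleftrightarrow> continuous_on {0..} (\<lambda>x. (v x, P x)) \<and> (v 0, P 0) = (1, 0) \<and>
    (\<forall>x>0. ((\<lambda>x. (v x, P x)) has_vector_derivative (1 / A x) *\<^sub>R sys lam x (v x, P x)) (at x))"
proof -
  have "continuous_on {0..} (\<lambda>x. (v x, P x)) \<longleftrightarrow> continuous_on {0..} v \<and> continuous_on {0..} P"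
    using continuous_on_fst[of "{0..}" "\<lambda>x. (v x, P x)"] continuous_on_snd[of "{0..}" "\<lambda>x. (v x, P x)"]
    by (auto intro: continuous_on_Pair)
  moreover have "((\<lambda>x. (v x, P x)) has_vector_derivative (a, b)) (at x) \<longleftrightarrow>
      (v has_vector_derivative a) (at x) \<and> (P has_vector_derivative b) (at x)" for a b x
    using bounded_linear.has_vector_derivative[OF bounded_linear_fst, of "\<lambda>x. (v x, P x)" "(a, b)"]
      bounded_linear.has_vector_derivative[OF bounded_linear_snd, of "\<lambda>x. (v x, P x)" "(a, b)"]
    by (auto intro: has_vector_derivative_Pair)
  ultimately show ?thesis by (auto simp: is_sol_def sys_def scaleR_Pair)
qed

lemma is_sol_exists: "\<exists>v P. is_sol lam v P"
proof -
  have "\<exists>z. continuous_on {0..} z \<and> z 0 = (1, 0) \<and>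
      (\<forall>x>0. (z has_vector_derivative (1 / A x) *\<^sub>R sys lam x (z x)) (at x))"
  proof (rule linear_ode_exists[where N = "sys lam" and ?z0.0 = "(1, 0)"])
    show "sys lam x (y - z) = sys lam x y - sys lam x z" for x y z
      by (simp add: sys_def algebra_simps)
    show "continuous_on {0..} (\<lambda>x. sys lam x (f x))" if "continuous_on {0..} f" for f
      unfolding sys_def by (intro continuous_intros that pot_continuous)
  qed (use sys_bound in auto)
  then obtain z where "continuous_on {0..} z" "z 0 = (1, 0)"
      "\<forall>x>0. (z has_vector_derivative (1 / A x) *\<^sub>R sys lam x (z x)) (at x)"
    by blast
  then have "is_sol lam (\<lambda>x. fst (z x)) (\<lambda>x. snd (z x))"
    by (simp add: is_sol_iff_sys)
  then show ?thesis by blast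
qed

lemma is_sol_unique:
  assumes "is_sol lam v P" "is_sol lam v' P'" "x \<ge> 0"
  shows "v x = v' x"
proof -
  have "(\<lambda>x. (v x, P x) - (v' x, P' x)) x = 0"
  proof (rule linear_ode_unique[where N = "sys lam"])
    fix t :: real assume t: "t > 0"
    show "((\<lambda>x. (v x, P x) - (v' x, P' x)) has_vector_derivative
        (1 / A t) *\<^sub>R sys lam t ((v t, P t) - (v' t, P' t))) (at t)"
    proof -
      have "(1 / A t) *\<^sub>R sys lam t ((v t, P t) - (v' t, P' t))
        = (1 / A t) *\<^sub>R sys lam t (v t, P t) - (1 / A t) *\<^sub>R sys lam t (v' t, P' t)"
        by (simp add: sys_def algebra_simps)
      then show ?thesis
        using assms t by (simp only:) (intro has_vector_derivative_diff; simp add: is_sol_iff_sys)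
    qed
  next
    show "continuous_on {0..} (\<lambda>x. (v x, P x) - (v' x, P' x))"
      using assms by (intro continuous_on_diff) (simp_all add: is_sol_iff_sys)
  qed (use sys_bound assms in \<open>auto simp: is_sol_def\<close>)
  then show ?thesis by (simp add: zero_prod_def)
qed

section \<open>Equivalence with the second-order problem\<close>

lemma is_sol_imp_radial_solution:
  assumes "is_sol lam v P"
  shows "radial_solution A k lam v"
  unfolding radial_solution_def
proof (intro conjI exI allI impI)
  show "continuous_on {0..} v" "v 0 = 1" using assms by (simp_all add: is_sol_def)
  define v' where "v' x = (1 / A x) *\<^sub>R P x" for x
  define v'' where "v'' x = (1 / A x) *\<^sub>R (1 / A x) *\<^sub>R (pot lam x * v x)
      - (deriv A x / (A x)\<^sup>2) *\<^sub>R P x" for x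
  show "((\<lambda>x. A x *\<^sub>R v' x) \<longlongrightarrow> 0) (at_right 0)"
  proof (rule Lim_transform_eventually)
    have "continuous (at_right 0) P"
      using assms by (auto simp: is_sol_def continuous_on_eq_continuous_within intro: continuous_within_subset)
    then show "(P \<longlongrightarrow> 0) (at_right 0)" using assms by (simp add: is_sol_def continuous_within)
    show "\<forall>\<^sub>F x in at_right 0. P x = A x *\<^sub>R v' x"
      using A_pos by (auto simp: eventually_at_right_field v'_def intro!: exI[of _ 1]) (metis order_less_irrefl)
  qed
  fix x :: real assume x: "x > 0"
  show "(v has_vector_derivative v' x) (at x)"
    using assms x by (simp add: is_sol_def v'_def)
  have inv: "((\<lambda>x. 1 / A x) has_real_derivative - (deriv A x / (A x)\<^sup>2)) (at x)"
    using A_deriv[OF x] A_pos[OF x]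
    by (auto intro!: derivative_eq_intros simp: power2_eq_square)
  have "((\<lambda>x. (1 / A x) *\<^sub>R P x) has_vector_derivative
      (1 / A x) *\<^sub>R ((1 / A x) *\<^sub>R (pot lam x * v x)) + (- (deriv A x / (A x)\<^sup>2)) *\<^sub>R P x) (at x)"
    using assms x by (intro has_vector_derivative_scaleR inv) (simp add: is_sol_def)
  then show "(v' has_vector_derivative v'' x) (at x)"
    by (simp add: v'_def[abs_def] v''_def)
  show "- v'' x - (deriv A x / A x) *\<^sub>R v' x + ((2 * of_int k * pi)\<^sup>2 / (A x)\<^sup>2) *\<^sub>R v x = lam * v x"
    using A_pos[OF x] unfolding c_def[symmetric] v'_def v''_def scaleR_conv_of_real
    by (simp add: pot_def field_simps power2_eq_square)
qed

lemma radial_solution_imp_is_sol: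
  assumes "radial_solution A k lam v"
  obtains P where "is_sol lam v P"
proof -
  obtain v' v'' where d: "\<And>x. x > 0 \<Longrightarrow> (v has_vector_derivative v' x) (at x)"
      "\<And>x. x > 0 \<Longrightarrow> (v' has_vector_derivative v'' x) (at x)"
      "\<And>x. x > 0 \<Longrightarrow> - v'' x - (deriv A x / A x) *\<^sub>R v' x + (c\<^sup>2 / (A x)\<^sup>2) *\<^sub>R v x = lam * v x"
      "((\<lambda>x. A x *\<^sub>R v' x) \<longlongrightarrow> 0) (at_right 0)"
    using assms by (auto simp: radial_solution_def c_def)
  \<comment> \<open>The value 0 at the origin turns the boundary condition on A v' into continuity
    of \<open>P\<close> there.\<close>
  define P where "P x = (if x \<le> 0 then 0 else A x *\<^sub>R v' x)" for x
  have P': "(P has_vector_derivative (1 / A x) *\<^sub>R (pot lam x * v x)) (at x)" if x: "x > 0" for x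
  proof (rule has_vector_derivative_transform_within_open[where S = "{0<..}"])
    have "((\<lambda>x. A x *\<^sub>R v' x) has_vector_derivative A x *\<^sub>R v'' x + deriv A x *\<^sub>R v' x) (at x)"
      by (intro has_vector_derivative_scaleR A_deriv d x)
    moreover have "A x *\<^sub>R v'' x + deriv A x *\<^sub>R v' x = (1 / A x) *\<^sub>R (pot lam x * v x)"
    proof -
      have v'': "v'' x = - (deriv A x / A x) *\<^sub>R v' x + (c\<^sup>2 / (A x)\<^sup>2) *\<^sub>R v x - lam * v x"
        using d(3)[OF x] by (simp add: algebra_simps)
      show ?thesis
        using A_pos[OF x] unfolding v'' scaleR_conv_of_real
        by (simp add: pot_def field_simps power2_eq_square)
    qed
    ultimately show "((\<lambda>x. A x *\<^sub>R v' x) has_vector_derivative (1 / A x) *\<^sub>R (pot lam x * v x)) (at x)"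
      by simp
  qed (use x in \<open>auto simp: P_def\<close>)
  have "continuous (at x within {0..}) P" if "x \<ge> 0" for x
  proof (cases "x = 0")
    case True
    have "(P \<longlongrightarrow> 0) (at_right 0)"
      by (rule Lim_transform_eventually[OF d(4)]) (auto simp: P_def eventually_at_right_field intro: exI[of _ 1])
    then have "(P \<longlongrightarrow> P 0) (at 0 within {0..})"
      by (simp add: P_def at_within_Ici_at_right)
    then show ?thesis using True by (simp add: continuous_within)
  next
    case False
    then have "isCont P x"
      using P'[of x] that has_vector_derivative_continuous by fastforce
    then show ?thesis by (rule continuous_at_imp_continuous_at_within)
  qed
  then have "continuous_on {0..} P" by (simp add: continuous_on_eq_continuous_within)
  then have "is_sol lam v P"
    using assms d P' A_pos by (auto simp: is_sol_def radial_solution_def P_def less_imp_neq[symmetric] d(1))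
  then show ?thesis using that by blast
qed

lemma v_fun_is_sol: obtains P where "is_sol lam (v_fun A k lam) P"
proof -
  define Q where "Q v \<longleftrightarrow> radial_solution A k lam v \<and> (\<forall>x<0. v x = 0)" for v
  obtain v P where v: "is_sol lam v P" using is_sol_exists by blast
  define w where "w x = (if x < 0 then 0 else v x)" for x
  have "is_sol lam w P"
    unfolding is_sol_def
  proof (intro conjI allI impI)
    show "continuous_on {0..} w"
      using v by (subst continuous_on_cong[where g = v]) (auto simp: w_def is_sol_def)
    fix x :: real assume x: "x > 0"
    show "(w has_vector_derivative (1 / A x) *\<^sub>R P x) (at x)"
      by (rule has_vector_derivative_transform_within_open[where S = "{0<..}" and f = v])
        (use v x in \<open>auto simp: is_sol_def w_def\<close>)
    show "(P has_vector_derivative (1 / A x) *\<^sub>R (pot lam x * w x)) (at x)"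
      using v x by (simp add: is_sol_def w_def)
  qed (use v in \<open>auto simp: is_sol_def w_def\<close>)
  then have "Q w" by (simp add: Q_def is_sol_imp_radial_solution w_def)
  moreover have "u = w" if "Q u" for u
  proof
    fix x
    obtain P' where "is_sol lam u P'"
      using \<open>Q u\<close> radial_solution_imp_is_sol by (auto simp: Q_def)
    then show "u x = w x"
      using is_sol_unique[OF _ \<open>is_sol lam w P\<close>] \<open>Q u\<close> by (cases "x < 0") (auto simp: Q_def w_def)
  qed
  ultimately have "Q (THE v. Q v)" by (rule theI)
  then have "radial_solution A k lam (v_fun A k lam)"
    by (simp add: v_fun_def Q_def)
  then show ?thesis using radial_solution_imp_is_sol that by blast
qed

text \<open>For \<lambda> = 0 the coefficient \<open>pot\<close> is the constant
  \<open>c\<^sup>2\<close>, so in the variable \<open>S\<close> the equation has constant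
  coefficients.\<close>

lemma v_fun_0:
  assumes "x \<ge> 0"
  shows "v_fun A k 0 x = of_real (cosh (c * S x))"
proof -
  have "is_sol 0 (\<lambda>x. of_real (cosh (c * S x))) (\<lambda>x. of_real (c * sinh (c * S x)))"
    unfolding is_sol_def
  proof (intro conjI allI impI)
    fix x :: real assume x: "x > 0"
    show "((\<lambda>x. complex_of_real (cosh (c * S x))) has_vector_derivative
        (1 / A x) *\<^sub>R of_real (c * sinh (c * S x))) (at x)"
      using S_deriv[OF x]
      by (auto intro!: derivative_eq_intros has_vector_derivative_of_real[THEN has_vector_derivative_eq_rhs]
          simp: scaleR_conv_of_real)
    show "((\<lambda>x. complex_of_real (c * sinh (c * S x))) has_vector_derivative
        (1 / A x) *\<^sub>R (pot 0 x * of_real (cosh (c * S x)))) (at x)"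
      using S_deriv[OF x]
      by (auto intro!: derivative_eq_intros has_vector_derivative_of_real[THEN has_vector_derivative_eq_rhs]
          simp: pot_def scaleR_conv_of_real power2_eq_square)
  qed (auto intro!: continuous_intros S_cont)
  then show ?thesis
    using v_fun_is_sol is_sol_unique assms by metis
qed

end

section \<open>Convergence of the discretization\<close>

lemma discrete_gronwall:
  fixes E :: "nat \<Rightarrow> real"
  assumes "E 0 = 0" and "\<And>j. j < n \<Longrightarrow> E (Suc j) \<le> exp (\<kappa> j) * (E j + s j)"
    and "\<And>j. j < n \<Longrightarrow> \<kappa> j \<ge> 0" "\<And>j. j < n \<Longrightarrow> s j \<ge> 0"
  shows "E n \<le> exp (\<Sum>j<n. \<kappa> j) * (\<Sum>j<n. s j)"
  using assms(2-)
proof (induction n)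
  case 0
  then show ?case using assms(1) by simp
next
  case (Suc n)
  have "(\<Sum>j<n. \<kappa> j) \<ge> 0" using Suc.prems by (intro sum_nonneg) auto
  then have "1 * s n \<le> exp (\<Sum>j<n. \<kappa> j) * s n"
    using Suc.prems by (intro mult_right_mono) auto
  then have "E n + s n \<le> exp (\<Sum>j<n. \<kappa> j) * (\<Sum>j<Suc n. s j)"
    using Suc.IH Suc.prems by (simp add: algebra_simps)
  then have "exp (\<kappa> n) * (E n + s n) \<le> exp (\<kappa> n) * (exp (\<Sum>j<n. \<kappa> j) * (\<Sum>j<Suc n. s j))"
    by (intro mult_left_mono) auto
  then have "E (Suc n) \<le> exp (\<kappa> n) * (exp (\<Sum>j<n. \<kappa> j) * (\<Sum>j<Suc n. s j))"
    using Suc.prems(1)[of n] by linarith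
  then show ?case
    by (simp add: exp_add mult_ac)
qed

context cone_profile
begin

text \<open>\<open>W n\<close> is approximately \<open>2 A(nh) / h\<close>, whence the eigenvalue \<open>\<lambda> h\<^sup>2 / 2\<close> and, in place of
  \<open>(2k\<pi>)\<^sup>2/A\<^sup>2\<close>, the potential \<open>c\<^sup>2 \<delta>\<^sup>2 / 2\<close>.\<close>

definition dphi :: "real \<Rightarrow> complex \<Rightarrow> nat \<Rightarrow> complex" where
  "dphi h lam n = discrete_sturm_liouville.dsol (\<lambda>n. 1 / \<delta> h n) (\<lambda>n. c\<^sup>2 * (\<delta> h n)\<^sup>2 / 2)
     (lam * of_real (h\<^sup>2 / 2)) n"

text \<open>Consistency and stability: the samples of \<open>v\<close> and \<open>P\<close> satisfy
  the scheme up to the defects \<open>\<tau>\<close> and \<open>\<sigma>\<close>, which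
  \<open>discrete_gronwall\<close> sums. A single \<open>\<eta>\<close> bounds \<open>h\<close>,
  \<open>S h\<close> and the three oscillations. In the last factor,
  \<open>(1 + c\<^sup>2) * S B\<close> and \<open>norm lam * (A B + V) * B\<close> come from the
  variation of \<open>v\<close>, \<open>P\<close>, \<open>A\<close> within a cell, and the multiple
  of \<open>V\<close> from replacing \<open>D.W n\<close> by its continuous counterpart.\<close>

lemma dphi_error_bound:
  assumes sol: "is_sol lam v P" and h: "0 < h" "h \<le> \<eta>" "S h \<le> \<eta>" and N: "real N * h \<le> B"
    and V: "\<And>t. t \<in> {0..B} \<Longrightarrow> norm (v t) \<le> V"
    and mod_v: "\<And>s t. s \<in> {0..B} \<Longrightarrow> t \<in> {0..B} \<Longrightarrow> \<bar>s - t\<bar> \<le> h \<Longrightarrow> norm (v s - v t) \<le> \<eta>"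
    and mod_P: "\<And>s t. s \<in> {0..B} \<Longrightarrow> t \<in> {0..B} \<Longrightarrow> \<bar>s - t\<bar> \<le> h \<Longrightarrow> norm (P s - P t) \<le> \<eta>"
    and mod_A: "\<And>s t. s \<in> {0..B} \<Longrightarrow> t \<in> {0..B} \<Longrightarrow> \<bar>s - t\<bar> \<le> h \<Longrightarrow> \<bar>A s - A t\<bar> \<le> \<eta>"
  shows "norm (dphi h lam N - v (real N * h)) \<le>
    exp ((1 + c\<^sup>2) * S B + norm lam * A B * B) *
    (((1 + c\<^sup>2) * S B + norm lam * (A B + V) * B + V * (2 * c\<^sup>2 + norm lam * (B + A B))) * \<eta>)"
proof -
  interpret D: discrete_sturm_liouville "\<lambda>n. 1 / \<delta> h n" "\<lambda>n. c\<^sup>2 * (\<delta> h n)\<^sup>2 / 2"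
    by (rule discretization[OF h(1)])
  define x where "x n = real n * h" for n
  have x0: "x 0 = 0" and x_Suc: "x (Suc n) = x n + h" for n
    by (simp_all add: x_def algebra_simps)
  have x_nonneg: "x n \<ge> 0" for n using h by (simp add: x_def)
  have x_le: "x n \<le> B" if "n \<le> N" for n
    using mult_right_mono[of "real n" "real N" h] that h(1) N unfolding x_def by linarith
  have B: "B \<ge> 0" using x_le[of 0] by (simp add: x0)
  have V0: "V \<ge> 0" using order_trans[OF norm_ge_zero V[of 0]] B by simp
  have AB: "A t \<le> A B" "A t \<ge> 0" if "t \<in> {0..B}" for t
    using A_mono[of t B] A_nonneg[of t] that by auto
  have \<eta>: "\<eta> > 0" using h by linarith
  have dp: "\<delta> h n > 0" for n by (rule \<delta>_pos[OF h(1)])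
  have \<delta>_eq: "\<delta> h n = S (x (Suc n)) - S (x n)" for n
    by (simp add: \<delta>_def x_def)
  have h_\<delta>: "\<exists>\<xi>\<in>{x n..x (Suc n)}. h / \<delta> h n = A \<xi>" for n
  proof -
    obtain \<xi> where \<xi>: "x n < \<xi>" "\<xi> < x (Suc n)" "\<delta> h n = h / A \<xi>"
      using \<delta>_mvt[OF h(1), of n] unfolding x_def by metis
    have "A \<xi> > 0" using \<xi> x_nonneg[of n] by (intro A_pos) simp
    then have "h / \<delta> h n = A \<xi>" using \<xi>(3) h(1) by simp
    then show ?thesis using \<xi> by (auto intro!: bexI[of _ \<xi>])
  qed
  define ell where "ell = lam * complex_of_real (h\<^sup>2 / 2)"
  define w where "w n = of_real (D.W n) * (of_real (c\<^sup>2 * (\<delta> h n)\<^sup>2 / 2) - ell)" for n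
  \<comment> \<open>Bounds the loss caused by \<open>D.W n\<close> averaging over two edges. It
    telescopes, so its sum is at most \<open>2 * \<delta> h 0\<close>; at \<open>n = 0\<close> there
    is no left edge and half the weight is missing.\<close>
  define d where "d n = (if n = 0 then \<delta> h 0 else \<delta> h (n - 1) - \<delta> h n)" for n
  \<comment> \<open>The missing left edge at 0 costs up to \<open>A B\<close>, but only once and
    multiplied by \<open>h\<close>.\<close>
  define r where "r n = \<eta> + (if n = 0 then A B else 0)" for n :: nat
  have Wq: "D.W n * (c\<^sup>2 * (\<delta> h n)\<^sup>2 / 2) \<le> c\<^sup>2 * \<delta> h n"
      "c\<^sup>2 * \<delta> h n \<le> D.W n * (c\<^sup>2 * (\<delta> h n)\<^sup>2 / 2) + c\<^sup>2 * d n" for n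
  proof -
    define t where "t = D.b' n * \<delta> h n"
    have eq: "D.W n * (c\<^sup>2 * (\<delta> h n)\<^sup>2 / 2) = c\<^sup>2 * (\<delta> h n * (1 + t) / 2)"
      using dp[of n] by (simp add: D.W_def t_def field_simps power2_eq_square)
    have t: "t \<le> 1" "0 \<le> t" "\<delta> h n * (1 - t) \<le> d n"
    proof -
      show "0 \<le> t" using D.b'_nonneg[of n] dp[of n] by (simp add: t_def)
      show "t \<le> 1" using \<delta>_antimono[OF h(1), of "n - 1" n] dp[of "n - 1"]
        by (cases n) (auto simp: t_def)
      show "\<delta> h n * (1 - t) \<le> d n"
      proof (cases n)
        case (Suc m)
        have "\<delta> h n * (1 - t) = (\<delta> h n / \<delta> h m) * (\<delta> h m - \<delta> h n)"
          using dp[of m] by (simp add: Suc t_def field_simps)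
        also have "\<dots> \<le> 1 * (\<delta> h m - \<delta> h n)"
          using \<delta>_antimono[OF h(1), of m n] dp[of m] Suc by (intro mult_right_mono) auto
        finally show ?thesis by (simp add: d_def Suc)
      qed (simp add: t_def d_def)
    qed
    have "\<delta> h n * (1 + t) / 2 \<le> \<delta> h n" using dp[of n] t by (simp add: field_simps)
    then show "D.W n * (c\<^sup>2 * (\<delta> h n)\<^sup>2 / 2) \<le> c\<^sup>2 * \<delta> h n"
      unfolding eq by (intro mult_left_mono) auto
    have "0 \<le> \<delta> h n * (1 - t)" using dp[of n] t by simp
    then have "\<delta> h n \<le> \<delta> h n * (1 + t) / 2 + d n" using t(3) by (simp add: field_simps)
    then have "c\<^sup>2 * \<delta> h n \<le> c\<^sup>2 * (\<delta> h n * (1 + t) / 2 + d n)"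
      by (intro mult_left_mono) auto
    then show "c\<^sup>2 * \<delta> h n \<le> D.W n * (c\<^sup>2 * (\<delta> h n)\<^sup>2 / 2) + c\<^sup>2 * d n"
      unfolding eq by (simp add: algebra_simps)
  qed
  have Wh: "0 \<le> D.W n * (h\<^sup>2 / 2)" "D.W n * (h\<^sup>2 / 2) \<le> h * A B"
      "\<bar>D.W n * (h\<^sup>2 / 2) - A (x n) * h\<bar> \<le> h * r n" if n: "n < N" for n
  proof -
    have eq: "D.W n * (h\<^sup>2 / 2) = h * ((h / \<delta> h n + h * D.b' n) / 2)"
      by (simp add: D.W_def field_simps power2_eq_square)
    obtain \<xi> where \<xi>: "\<xi> \<in> {x n..x (Suc n)}" "h / \<delta> h n = A \<xi>" using h_\<delta> by blast
    have \<xi>B: "\<xi> \<in> {0..B}" "x n \<in> {0..B}"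
      using \<xi> x_nonneg[of n] x_le[of "Suc n"] x_le[of n] n by auto
    have 1: "0 \<le> h / \<delta> h n" "h / \<delta> h n \<le> A B" "\<bar>h / \<delta> h n - A (x n)\<bar> \<le> \<eta>"
      using AB[OF \<xi>B(1)] mod_A[OF \<xi>B] \<xi> by (auto simp: x_Suc)
    have 2: "0 \<le> h * D.b' n \<and> h * D.b' n \<le> A B \<and> \<bar>h * D.b' n - A (x n)\<bar> \<le> r n"
    proof (cases n)
      case 0
      then show ?thesis using AB[OF \<xi>B(2)] \<eta> by (simp add: r_def)
    next
      case (Suc m)
      obtain \<xi> where \<xi>: "\<xi> \<in> {x m..x n}" "h / \<delta> h m = A \<xi>" using h_\<delta>[of m] Suc by blast
      have \<xi>B: "\<xi> \<in> {0..B}" "x n \<in> {0..B}"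
        using \<xi> x_nonneg[of m] x_nonneg[of n] x_le[of n] n by auto
      show ?thesis
        using AB[OF \<xi>B(1)] mod_A[OF \<xi>B] \<xi> by (auto simp: Suc x_Suc r_def)
    qed
    show "0 \<le> D.W n * (h\<^sup>2 / 2)" unfolding eq using 1 2 h by simp
    show "D.W n * (h\<^sup>2 / 2) \<le> h * A B" unfolding eq using 1 2 h by (intro mult_left_mono) auto
    have "D.W n * (h\<^sup>2 / 2) - A (x n) * h = h * ((h / \<delta> h n + h * D.b' n) / 2 - A (x n))"
      unfolding eq by (simp add: algebra_simps)
    moreover have "\<bar>(h / \<delta> h n + h * D.b' n) / 2 - A (x n)\<bar> \<le> r n"
    proof -
      have "\<eta> \<le> r n" using AB[of 0] B by (simp add: r_def)
      then show ?thesis using 1 2 by (auto simp: abs_le_iff field_simps)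
    qed
    ultimately show "\<bar>D.W n * (h\<^sup>2 / 2) - A (x n) * h\<bar> \<le> h * r n"
      using h(1) by (simp add: abs_mult)
  qed
  have w_eq: "w n = of_real (D.W n * (c\<^sup>2 * (\<delta> h n)\<^sup>2 / 2)) - lam * of_real (D.W n * (h\<^sup>2 / 2))" for n
    by (simp add: w_def ell_def algebra_simps)
  have w_le: "norm (w n) \<le> c\<^sup>2 * \<delta> h n + norm lam * A B * h" if n: "n < N" for n
  proof -
    have "norm (w n) \<le> norm (complex_of_real (D.W n * (c\<^sup>2 * (\<delta> h n)\<^sup>2 / 2)))
        + norm (lam * of_real (D.W n * (h\<^sup>2 / 2)))"
      unfolding w_eq by (rule norm_triangle_ineq4)
    also have "\<dots> = D.W n * (c\<^sup>2 * (\<delta> h n)\<^sup>2 / 2) + norm lam * (D.W n * (h\<^sup>2 / 2))"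
      unfolding norm_mult norm_of_real using D.W_pos[of n] Wh(1)[OF n] by (simp add: abs_mult)
    also have "\<dots> \<le> c\<^sup>2 * \<delta> h n + norm lam * (h * A B)"
      by (intro add_mono Wq mult_left_mono Wh n norm_ge_zero)
    finally show ?thesis by (simp add: mult_ac)
  qed
  have w_diff: "norm (w n - (of_real (c\<^sup>2 * \<delta> h n) - lam * of_real (A (x n) * h)))
      \<le> c\<^sup>2 * d n + norm lam * (h * r n)" if n: "n < N" for n
  proof -
    have "norm (w n - (of_real (c\<^sup>2 * \<delta> h n) - lam * of_real (A (x n) * h)))
        = norm (of_real (D.W n * (c\<^sup>2 * (\<delta> h n)\<^sup>2 / 2) - c\<^sup>2 * \<delta> h n)
          - lam * of_real (D.W n * (h\<^sup>2 / 2) - A (x n) * h))"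
      unfolding w_eq by (intro arg_cong[where f = norm]) (simp add: algebra_simps)
    also have "\<dots> \<le> norm (complex_of_real (D.W n * (c\<^sup>2 * (\<delta> h n)\<^sup>2 / 2) - c\<^sup>2 * \<delta> h n))
        + norm (lam * of_real (D.W n * (h\<^sup>2 / 2) - A (x n) * h))"
      by (rule norm_triangle_ineq4)
    also have "\<dots> \<le> c\<^sup>2 * d n + norm lam * (h * r n)"
      unfolding norm_mult norm_of_real
    proof (rule add_mono)
      have "\<bar>a - b\<bar> \<le> e" if "a \<le> b" "b \<le> a + e" for a b e :: real
        using that by linarith
      from this[OF Wq[of n]]
      show "\<bar>D.W n * (c\<^sup>2 * (\<delta> h n)\<^sup>2 / 2) - c\<^sup>2 * \<delta> h n\<bar> \<le> c\<^sup>2 * d n" .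
      show "norm lam * \<bar>D.W n * (h\<^sup>2 / 2) - A (x n) * h\<bar> \<le> norm lam * (h * r n)"
        by (rule mult_left_mono[OF Wh(3)[OF n] norm_ge_zero])
    qed
    finally show ?thesis .
  qed
  have sol_v: "continuous_on {0..} v" and sol_P: "continuous_on {0..} P" and v0: "v 0 = 1" and P0: "P 0 = 0"
    and v': "\<And>x. x > 0 \<Longrightarrow> (v has_vector_derivative (1 / A x) *\<^sub>R P x) (at x)"
    and P': "\<And>x. x > 0 \<Longrightarrow> (P has_vector_derivative (1 / A x) *\<^sub>R (pot lam x * v x)) (at x)"
    using sol by (auto simp: is_sol_def)
  \<comment> \<open>The scheme updates the momentum first and then uses the new value, so the defect
    is measured against \<open>P\<close> at the right end of the cell.\<close>
  have \<tau>: "norm (v (x (Suc n)) - v (x n) - \<delta> h n *\<^sub>R P (x (Suc n))) \<le> \<eta> * \<delta> h n" if n: "n < N" for n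
  proof -
    let ?p = "P (x (Suc n))"
    have "norm ((v (x (Suc n)) - S (x (Suc n)) *\<^sub>R ?p) - (v (x n) - S (x n) *\<^sub>R ?p))
        \<le> \<eta> * S (x (Suc n)) - \<eta> * S (x n)"
    proof (rule differentiable_bound_general)
      show "x n < x (Suc n)" using h by (simp add: x_Suc)
      show "continuous_on {x n..x (Suc n)} (\<lambda>t. v t - S t *\<^sub>R ?p)"
        "continuous_on {x n..x (Suc n)} (\<lambda>t. \<eta> * S t)"
        by (intro continuous_intros continuous_on_subset[OF sol_v] continuous_on_subset[OF S_cont];
            use x_nonneg[of n] in auto)+
      fix t assume t: "x n < t" "t < x (Suc n)"
      then have t0: "t > 0" using x_nonneg[of n] by simp
      show "((\<lambda>t. v t - S t *\<^sub>R ?p) has_vector_derivative (1 / A t) *\<^sub>R P t - (1 / A t) *\<^sub>R ?p) (at t)"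
        using has_vector_derivative_diff[OF v'[OF t0]
          has_vector_derivative_scaleR[OF S_deriv[OF t0] has_vector_derivative_const[of ?p]]] by simp
      show "((\<lambda>t. \<eta> * S t) has_vector_derivative \<eta> * (1 / A t)) (at t)"
        using DERIV_cmult[OF S_deriv[OF t0], of \<eta>]
        by (simp add: has_real_derivative_iff_has_vector_derivative)
      have "norm (P t - ?p) \<le> \<eta>"
        using t x_nonneg[of n] x_nonneg[of "Suc n"] x_le[of "Suc n"] n by (intro mod_P) (auto simp: x_Suc)
      then show "norm ((1 / A t) *\<^sub>R P t - (1 / A t) *\<^sub>R ?p) \<le> \<eta> * (1 / A t)"
        using A_pos[OF t0] by (simp add: divide_right_mono flip: scaleR_diff_right)
    qed
    then show ?thesis by (simp add: \<delta>_eq algebra_simps)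
  qed
  have \<sigma>1: "norm (P (x (Suc n)) - P (x n) - (of_real (c\<^sup>2 * \<delta> h n) - lam * of_real (A (x n) * h)) * v (x n))
      \<le> c\<^sup>2 * \<eta> * \<delta> h n + norm lam * ((A B + V) * \<eta>) * h" if n: "n < N" for n
  proof -
    define u where "u = v (x n)"
    \<comment> \<open>\<open>P\<close> minus its evolution with \<open>v\<close> and
      \<open>A\<close> frozen at \<open>x n\<close> in the source terms c^2 v / A and \<lambda> A v;
      the factor 1/A is not frozen but integrated exactly through \<open>S\<close>.\<close>
    define G where "G t = P t - S t *\<^sub>R (of_real (c\<^sup>2) * u) + t *\<^sub>R (lam * of_real (A (x n)) * u)" for t
    define \<Phi> where "\<Phi> t = c\<^sup>2 * \<eta> * S t + norm lam * ((A B + V) * \<eta>) * t" for t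
    have "norm (G (x (Suc n)) - G (x n)) \<le> \<Phi> (x (Suc n)) - \<Phi> (x n)"
    proof (rule differentiable_bound_general)
      show "x n < x (Suc n)" using h by (simp add: x_Suc)
      show "continuous_on {x n..x (Suc n)} G" "continuous_on {x n..x (Suc n)} \<Phi>"
        unfolding G_def \<Phi>_def
        by (intro continuous_intros continuous_on_subset[OF sol_P] continuous_on_subset[OF S_cont];
            use x_nonneg[of n] in auto)+
      fix t assume t: "x n < t" "t < x (Suc n)"
      then have t0: "t > 0" using x_nonneg[of n] by simp
      have tB: "t \<in> {0..B}" "x n \<in> {0..B}" "\<bar>t - x n\<bar> \<le> h"
        using t x_nonneg[of n] x_le[of "Suc n"] n by (auto simp: x_Suc)
      show "(G has_vector_derivative (1 / A t) *\<^sub>R (pot lam t * v t) - (1 / A t) *\<^sub>R (of_real (c\<^sup>2) * u)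
          + lam * of_real (A (x n)) * u) (at t)"
        unfolding G_def
        using has_vector_derivative_add[OF has_vector_derivative_diff[OF P'[OF t0]
          has_vector_derivative_scaleR[OF S_deriv[OF t0] has_vector_derivative_const[of "of_real (c\<^sup>2) * u"]]]
          has_vector_derivative_scaleR[OF DERIV_ident has_vector_derivative_const[of "lam * of_real (A (x n)) * u"]]]
        by simp
      show "(\<Phi> has_vector_derivative c\<^sup>2 * \<eta> * (1 / A t) + norm lam * ((A B + V) * \<eta>)) (at t)"
        using DERIV_add[OF DERIV_cmult[OF S_deriv[OF t0], of "c\<^sup>2 * \<eta>"]
            DERIV_cmult[OF DERIV_ident, of "norm lam * ((A B + V) * \<eta>)"]]
        by (simp add: \<Phi>_def[abs_def] has_real_derivative_iff_has_vector_derivative)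
      have "norm ((1 / A t) *\<^sub>R (pot lam t * v t) - (1 / A t) *\<^sub>R (of_real (c\<^sup>2) * u) + lam * of_real (A (x n)) * u)
        = norm (of_real (c\<^sup>2 * (1 / A t)) * (v t - u) - lam * (of_real (A t) * (v t - u) + of_real (A t - A (x n)) * u))"
        using A_pos[OF t0] by (intro arg_cong[where f = norm]) (simp add: pot_def scaleR_conv_of_real field_simps power2_eq_square)
      also have "\<dots> \<le> norm (of_real (c\<^sup>2 * (1 / A t)) * (v t - u))
          + norm (lam * (of_real (A t) * (v t - u) + of_real (A t - A (x n)) * u))"
        by (rule norm_triangle_ineq4)
      also have "\<dots> \<le> c\<^sup>2 * (1 / A t) * \<eta> + norm lam * (A B * \<eta> + \<eta> * V)"
      proof (rule add_mono)
        have vu: "norm (v t - u) \<le> \<eta>" unfolding u_def by (rule mod_v[OF tB])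
        then show "norm (of_real (c\<^sup>2 * (1 / A t)) * (v t - u)) \<le> c\<^sup>2 * (1 / A t) * \<eta>"
          unfolding norm_mult norm_of_real using A_pos[OF t0] by (simp add: mult_left_mono divide_right_mono)
        have "norm (of_real (A t) * (v t - u) + of_real (A t - A (x n)) * u)
            \<le> norm (of_real (A t) * (v t - u)) + norm (of_real (A t - A (x n)) * u)"
          by (rule norm_triangle_ineq)
        also have "\<dots> \<le> A B * \<eta> + \<eta> * V"
          unfolding norm_mult norm_of_real
          by (intro add_mono mult_mono vu mod_A tB) (use AB[OF tB(1)] \<eta> V[OF tB(2)] AB[of B] B in \<open>auto simp: u_def\<close>)
        finally show "norm (lam * (of_real (A t) * (v t - u) + of_real (A t - A (x n)) * u))
            \<le> norm lam * (A B * \<eta> + \<eta> * V)"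
          unfolding norm_mult by (intro mult_left_mono) auto
      qed
      finally show "norm ((1 / A t) *\<^sub>R (pot lam t * v t) - (1 / A t) *\<^sub>R (of_real (c\<^sup>2) * u)
          + lam * of_real (A (x n)) * u) \<le> c\<^sup>2 * \<eta> * (1 / A t) + norm lam * ((A B + V) * \<eta>)"
        by (simp add: algebra_simps)
    qed
    moreover have "G (x (Suc n)) - G (x n)
        = P (x (Suc n)) - P (x n) - (of_real (c\<^sup>2 * \<delta> h n) - lam * of_real (A (x n) * h)) * v (x n)"
      by (simp add: G_def u_def \<delta>_eq x_Suc scaleR_conv_of_real algebra_simps)
    moreover have "\<Phi> (x (Suc n)) - \<Phi> (x n) = c\<^sup>2 * \<eta> * \<delta> h n + norm lam * ((A B + V) * \<eta>) * h"
      by (simp add: \<Phi>_def \<delta>_eq x_Suc algebra_simps)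
    ultimately show ?thesis by simp
  qed
  define \<sigma> where "\<sigma> n = c\<^sup>2 * \<eta> * \<delta> h n + norm lam * ((A B + V) * \<eta>) * h
      + (c\<^sup>2 * d n + norm lam * (h * r n)) * V" for n
  have \<sigma>: "norm (P (x (Suc n)) - P (x n) - w n * v (x n)) \<le> \<sigma> n" if n: "n < N" for n
  proof -
    let ?w = "of_real (c\<^sup>2 * \<delta> h n) - lam * of_real (A (x n) * h)"
    have "norm (P (x (Suc n)) - P (x n) - w n * v (x n))
        = norm ((P (x (Suc n)) - P (x n) - ?w * v (x n)) - (w n - ?w) * v (x n))"
      by (intro arg_cong[where f = norm]) (simp add: algebra_simps)
    also have "\<dots> \<le> norm (P (x (Suc n)) - P (x n) - ?w * v (x n)) + norm ((w n - ?w) * v (x n))"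
      by (rule norm_triangle_ineq4)
    also have "\<dots> \<le> \<sigma> n"
      unfolding \<sigma>_def norm_mult
      by (intro add_mono \<sigma>1 mult_mono w_diff n V order_trans[OF norm_ge_zero w_diff])
        (use x_nonneg[of n] x_le[of n] n in auto)
    finally show ?thesis .
  qed
  define \<phi> where "\<phi> = D.dsol ell"
  define m where "m = D.dmom ell"
  define E where "E n = norm (\<phi> n - v (x n)) + norm (m n - P (x n))" for n
  define s where "s n = \<sigma> n + \<eta> * \<delta> h n" for n
  define \<kappa> where "\<kappa> n = (1 + c\<^sup>2) * \<delta> h n + norm lam * A B * h" for n
  have \<sigma>_nonneg: "\<sigma> n \<ge> 0" if "n < N" for n
    using \<sigma>[OF that] norm_ge_zero order_trans by blast
  have "E N \<le> exp (\<Sum>j<N. \<kappa> j) * (\<Sum>j<N. s j)"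
  proof (rule discrete_gronwall)
    show "E 0 = 0" by (simp add: E_def \<phi>_def m_def x0 v0 P0)
    fix n assume n: "n < N"
    show "\<kappa> n \<ge> 0" using dp[of n] AB[of B] B h by (simp add: \<kappa>_def)
    show "s n \<ge> 0" using \<sigma>_nonneg[OF n] \<eta> dp[of n] by (simp add: s_def)
    let ?\<sigma> = "P (x (Suc n)) - P (x n) - w n * v (x n)"
    let ?\<tau> = "v (x (Suc n)) - v (x n) - \<delta> h n *\<^sub>R P (x (Suc n))"
    have m_Suc: "m (Suc n) = m n + w n * \<phi> n" and \<phi>_Suc: "\<phi> (Suc n) = \<phi> n + \<delta> h n *\<^sub>R m (Suc n)"
      by (simp_all add: m_def \<phi>_def w_def scaleR_conv_of_real)
    have "norm (m (Suc n) - P (x (Suc n))) = norm ((m n - P (x n)) + w n * (\<phi> n - v (x n)) - ?\<sigma>)"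
      by (intro arg_cong[where f = norm]) (simp add: m_Suc algebra_simps)
    also have "\<dots> \<le> norm (m n - P (x n)) + norm (w n) * norm (\<phi> n - v (x n)) + \<sigma> n"
      unfolding norm_mult[symmetric]
      by (intro order_trans[OF norm_triangle_ineq4] add_mono norm_triangle_ineq \<sigma> n)
    finally have f: "norm (m (Suc n) - P (x (Suc n)))
        \<le> norm (m n - P (x n)) + norm (w n) * norm (\<phi> n - v (x n)) + \<sigma> n" .
    have nrm: "norm (\<delta> h n *\<^sub>R (m (Suc n) - P (x (Suc n)))) = \<delta> h n * norm (m (Suc n) - P (x (Suc n)))"
      using dp[of n] by simp
    have "norm (\<phi> (Suc n) - v (x (Suc n))) = norm ((\<phi> n - v (x n)) + \<delta> h n *\<^sub>R (m (Suc n) - P (x (Suc n))) - ?\<tau>)"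
      by (intro arg_cong[where f = norm]) (simp add: \<phi>_Suc algebra_simps)
    also have "\<dots> \<le> norm (\<phi> n - v (x n)) + \<delta> h n * norm (m (Suc n) - P (x (Suc n))) + \<eta> * \<delta> h n"
      unfolding nrm[symmetric] by (intro order_trans[OF norm_triangle_ineq4] add_mono norm_triangle_ineq \<tau> n)
    finally have "E (Suc n) \<le> norm (\<phi> n - v (x n)) + \<eta> * \<delta> h n + (1 + \<delta> h n) * norm (m (Suc n) - P (x (Suc n)))"
      by (simp add: E_def algebra_simps)
    also have "\<dots> \<le> norm (\<phi> n - v (x n)) + \<eta> * \<delta> h n
        + (1 + \<delta> h n) * (norm (m n - P (x n)) + norm (w n) * norm (\<phi> n - v (x n)) + \<sigma> n)"
      using f dp[of n] by (intro add_left_mono mult_left_mono) auto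
    \<comment> \<open>The two half-steps contribute one factor each; bounding both by exponentials
      gives the exponent \<open>\<kappa> n\<close>.\<close>
    also have "\<dots> \<le> (1 + \<delta> h n) * ((1 + norm (w n)) * (E n + s n))"
    proof -
      have "norm (\<phi> n - v (x n)) + \<eta> * \<delta> h n \<le> (1 + \<delta> h n) * (norm (\<phi> n - v (x n)) + \<eta> * \<delta> h n)"
        using dp[of n] \<eta> by (simp add: algebra_simps)
      moreover have "norm (\<phi> n - v (x n)) + \<eta> * \<delta> h n
          + (norm (m n - P (x n)) + norm (w n) * norm (\<phi> n - v (x n)) + \<sigma> n)
          \<le> (1 + norm (w n)) * (E n + s n)"
        using dp[of n] \<eta> \<sigma>_nonneg[OF n] by (simp add: E_def s_def algebra_simps)
      then have "(1 + \<delta> h n) * (norm (\<phi> n - v (x n)) + \<eta> * \<delta> h n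
          + (norm (m n - P (x n)) + norm (w n) * norm (\<phi> n - v (x n)) + \<sigma> n))
          \<le> (1 + \<delta> h n) * ((1 + norm (w n)) * (E n + s n))"
        using dp[of n] by (intro mult_left_mono) auto
      ultimately show ?thesis by (simp add: distrib_left)
    qed
    also have "\<dots> \<le> exp (\<delta> h n) * (exp (c\<^sup>2 * \<delta> h n + norm lam * A B * h) * (E n + s n))"
    proof (intro mult_mono)
      show "1 + \<delta> h n \<le> exp (\<delta> h n)" by simp
      show "1 + norm (w n) \<le> exp (c\<^sup>2 * \<delta> h n + norm lam * A B * h)"
        using w_le[OF n] exp_ge_add_one_self[of "c\<^sup>2 * \<delta> h n + norm lam * A B * h"] by linarith
    qed (use \<open>s n \<ge> 0\<close> in \<open>auto simp: E_def\<close>)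
    also have "\<dots> = exp (\<kappa> n) * (E n + s n)"
    proof -
      have "\<kappa> n = \<delta> h n + (c\<^sup>2 * \<delta> h n + norm lam * A B * h)"
        by (simp add: \<kappa>_def algebra_simps)
      then show ?thesis by (simp only: exp_add[of "\<delta> h n"] mult.assoc)
    qed
    finally show "E (Suc n) \<le> exp (\<kappa> n) * (E n + s n)" .
  qed
  also have "\<dots> \<le> exp ((1 + c\<^sup>2) * S B + norm lam * A B * B) *
    (((1 + c\<^sup>2) * S B + norm lam * (A B + V) * B + V * (2 * c\<^sup>2 + norm lam * (B + A B))) * \<eta>)"
  proof (intro mult_mono)
    have xN: "real N * h \<le> B" "real N * h \<ge> 0" using N h by auto
    have sum_\<delta>: "(\<Sum>j<N. \<delta> h j) \<le> S B"
    proof -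
      have "(\<Sum>j<N. \<delta> h j) = S (x N) - S (x 0)"
        unfolding \<delta>_eq by (rule sum_lessThan_telescope)
      also have "\<dots> \<le> S B" using S_mono[OF x_nonneg x_le[of N]] by (simp add: x0)
      finally show ?thesis .
    qed
    have sum_d: "(\<Sum>j<N. d j) \<le> 2 * \<eta>"
    proof -
      have *: "(\<Sum>j<Suc n. d j) = 2 * \<delta> h 0 - \<delta> h n" for n
        by (induction n) (simp_all add: d_def)
      have "\<delta> h 0 \<le> \<eta>" using h by (simp add: \<delta>_def)
      then show ?thesis using *[of "N - 1"] dp[of "N - 1"] \<eta> by (cases N) auto
    qed
    have sum_r: "(\<Sum>j<N. h * r j) \<le> (B + A B) * \<eta>"
    proof -
      have "(\<Sum>j<n. h * r j) \<le> real n * h * \<eta> + h * A B" for n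
        using AB[of B] B h by (induction n) (auto simp: r_def algebra_simps)
      from this[of N] have "(\<Sum>j<N. h * r j) \<le> real N * h * \<eta> + h * A B" .
      also have "\<dots> \<le> B * \<eta> + \<eta> * A B"
        using xN h \<eta> AB[of B] B by (intro add_mono mult_right_mono) auto
      finally show ?thesis by (simp add: algebra_simps)
    qed
    show "exp (\<Sum>j<N. \<kappa> j) \<le> exp ((1 + c\<^sup>2) * S B + norm lam * A B * B)"
    proof -
      have "(\<Sum>j<N. \<kappa> j) = (1 + c\<^sup>2) * (\<Sum>j<N. \<delta> h j) + norm lam * A B * (real N * h)"
        by (simp add: \<kappa>_def sum.distrib sum_distrib_left)
      also have "\<dots> \<le> (1 + c\<^sup>2) * S B + norm lam * A B * B"
        using sum_\<delta> xN AB[of B] B by (intro add_mono mult_left_mono) auto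
      finally show ?thesis by simp
    qed
    have "(\<Sum>j<N. s j) = (1 + c\<^sup>2) * \<eta> * (\<Sum>j<N. \<delta> h j) + norm lam * ((A B + V) * \<eta>) * (real N * h)
        + (c\<^sup>2 * (\<Sum>j<N. d j) + norm lam * (\<Sum>j<N. h * r j)) * V"
      by (simp add: s_def \<sigma>_def sum.distrib algebra_simps flip: sum_distrib_left sum_distrib_right)
    also have "\<dots> \<le> (1 + c\<^sup>2) * \<eta> * S B + norm lam * ((A B + V) * \<eta>) * B
        + (c\<^sup>2 * (2 * \<eta>) + norm lam * ((B + A B) * \<eta>)) * V"
      using sum_\<delta> sum_d sum_r xN \<eta> V0 AB[of B] B by (intro add_mono mult_left_mono mult_right_mono) auto
    also have "\<dots> = ((1 + c\<^sup>2) * S B + norm lam * (A B + V) * B + V * (2 * c\<^sup>2 + norm lam * (B + A B))) * \<eta>"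
      by (simp add: algebra_simps)
    finally show "(\<Sum>j<N. s j) \<le> ((1 + c\<^sup>2) * S B + norm lam * (A B + V) * B
        + V * (2 * c\<^sup>2 + norm lam * (B + A B))) * \<eta>" .
    show "0 \<le> (\<Sum>j<N. s j)"
      unfolding s_def
      by (intro sum_nonneg add_nonneg_nonneg mult_nonneg_nonneg \<sigma>_nonneg less_imp_le[OF dp] less_imp_le[OF \<eta>]) simp
  qed simp
  finally show ?thesis
    unfolding E_def \<phi>_def ell_def dphi_def x_def using norm_ge_zero by (smt (verit))
qed

text \<open>The constant \<open>C\<close> is independent of \<open>h\<close> and \<open>n\<close>,
  so uniform continuity on compact intervals supplies an admissible mesh.\<close>

lemma dphi_convergence:
  assumes sol: "is_sol lam v P" and "\<epsilon> > 0" and "B > 0"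
  obtains h0 where "h0 > 0"
    "\<And>h n. 0 < h \<Longrightarrow> h < h0 \<Longrightarrow> real n * h \<le> B \<Longrightarrow> norm (dphi h lam n - v (real n * h)) < \<epsilon>"
proof -
  have cont: "continuous_on {0..B} v" "continuous_on {0..B} P" "continuous_on {0..B} A" "continuous_on {0..1} S"
    using sol A_cont S_cont by (auto simp: is_sol_def elim: continuous_on_subset)
  have "bounded (v ` {0..B})"
    using cont by (intro compact_imp_bounded compact_continuous_image) auto
  then obtain V where "\<forall>y\<in>v ` {0..B}. norm y \<le> V"
    unfolding bounded_iff by blast
  then have V: "\<And>t. t \<in> {0..B} \<Longrightarrow> norm (v t) \<le> V" by blast
  define C where "C = exp ((1 + c\<^sup>2) * S B + norm lam * A B * B) *
    ((1 + c\<^sup>2) * S B + norm lam * (A B + V) * B + V * (2 * c\<^sup>2 + norm lam * (B + A B)))"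
  have "V \<ge> 0" using order_trans[OF norm_ge_zero V[of 0]] \<open>B > 0\<close> by simp
  then have "C \<ge> 0"
    unfolding C_def using S_nonneg[of B] A_nonneg[of B] \<open>B > 0\<close>
    by (intro mult_nonneg_nonneg add_nonneg_nonneg) auto
  define \<eta> where "\<eta> = \<epsilon> / (C + 1)"
  have \<eta>: "\<eta> > 0" using \<open>C \<ge> 0\<close> \<open>\<epsilon> > 0\<close> by (simp add: \<eta>_def)
  have "C * \<eta> < (C + 1) * \<eta>" using \<eta> by (simp add: algebra_simps)
  then have C\<eta>: "C * \<eta> < \<epsilon>" using \<open>C \<ge> 0\<close> by (simp add: \<eta>_def)
  have unif: "uniformly_continuous_on {0..B} v" "uniformly_continuous_on {0..B} P"
      "uniformly_continuous_on {0..B} A" "uniformly_continuous_on {0..1} S"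
    using cont by (auto intro: compact_uniformly_continuous)
  obtain d1 where d1: "d1 > 0" "\<And>s t. s \<in> {0..B} \<Longrightarrow> t \<in> {0..B} \<Longrightarrow> \<bar>s - t\<bar> < d1 \<Longrightarrow> norm (v s - v t) < \<eta>"
    using uniformly_continuous_onE[OF unif(1) \<eta>] unfolding dist_norm real_norm_def by metis
  obtain d2 where d2: "d2 > 0" "\<And>s t. s \<in> {0..B} \<Longrightarrow> t \<in> {0..B} \<Longrightarrow> \<bar>s - t\<bar> < d2 \<Longrightarrow> norm (P s - P t) < \<eta>"
    using uniformly_continuous_onE[OF unif(2) \<eta>] unfolding dist_norm real_norm_def by metis
  obtain d3 where d3: "d3 > 0" "\<And>s t. s \<in> {0..B} \<Longrightarrow> t \<in> {0..B} \<Longrightarrow> \<bar>s - t\<bar> < d3 \<Longrightarrow> \<bar>A s - A t\<bar> < \<eta>"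
    using uniformly_continuous_onE[OF unif(3) \<eta>] unfolding dist_norm real_norm_def by metis
  obtain d4 where d4: "d4 > 0" "\<And>s t. s \<in> {0..1} \<Longrightarrow> t \<in> {0..1} \<Longrightarrow> \<bar>s - t\<bar> < d4 \<Longrightarrow> \<bar>S s - S t\<bar> < \<eta>"
    using uniformly_continuous_onE[OF unif(4) \<eta>] unfolding dist_norm real_norm_def by metis
  \<comment> \<open>The entry 1 keeps \<open>h\<close> in the interval where the modulus of
    \<open>S\<close> was taken; with \<open>S 0 = 0\<close> that modulus yields
    \<open>S h \<le> \<eta>\<close>.\<close>
  define h0 where "h0 = Min {d1, d2, d3, d4, \<eta>, 1}"
  show ?thesis
  proof
    show "h0 > 0" using d1 d2 d3 d4 \<eta> by (simp add: h0_def)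
    fix h n assume h: "0 < h" "h < h0" and n: "real n * h \<le> B"
    have small: "h < d1" "h < d2" "h < d3" "h < d4" "h \<le> \<eta>" "h \<le> 1"
      using h(2) by (simp_all add: h0_def)
    have "norm (dphi h lam n - v (real n * h)) \<le>
      exp ((1 + c\<^sup>2) * S B + norm lam * A B * B) *
      (((1 + c\<^sup>2) * S B + norm lam * (A B + V) * B + V * (2 * c\<^sup>2 + norm lam * (B + A B))) * \<eta>)"
    proof (rule dphi_error_bound[OF sol h(1) _ _ n V])
      show "h \<le> \<eta>" by (rule small)
      show "S h \<le> \<eta>" using d4(2)[of h 0] small h by simp
      show "norm (v s - v t) \<le> \<eta>" if "s \<in> {0..B}" "t \<in> {0..B}" "\<bar>s - t\<bar> \<le> h" for s t
        by (rule less_imp_le[OF d1(2)[OF that(1,2) le_less_trans[OF that(3) small(1)]]])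
      show "norm (P s - P t) \<le> \<eta>" if "s \<in> {0..B}" "t \<in> {0..B}" "\<bar>s - t\<bar> \<le> h" for s t
        by (rule less_imp_le[OF d2(2)[OF that(1,2) le_less_trans[OF that(3) small(2)]]])
      show "\<bar>A s - A t\<bar> \<le> \<eta>" if "s \<in> {0..B}" "t \<in> {0..B}" "\<bar>s - t\<bar> \<le> h" for s t
        by (rule less_imp_le[OF d3(2)[OF that(1,2) le_less_trans[OF that(3) small(3)]]])
    qed
    also have "\<dots> = C * \<eta>" by (simp add: C_def)
    finally show "norm (dphi h lam n - v (real n * h)) < \<epsilon>" using C\<eta> by linarith
  qed
qed

end

section \<open>Passage to the limit\<close>

text \<open>Confinement to one interval gives tightness. Subsequence and limit are obtained before
  \<open>f\<close>, which later makes the measure the same for every \<lambda>.\<close>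

theorem finite_distributions_weak_limit:
  fixes p pt :: "nat \<Rightarrow> nat \<Rightarrow> real" and K :: "nat \<Rightarrow> nat"
  assumes p: "\<And>N i. p N i \<ge> 0" "\<And>N. (\<Sum>i\<le>K N. p N i) = 1"
    and pt: "\<And>N i. i \<le> K N \<Longrightarrow> pt N i \<in> {a..b}"
  obtains r \<nu> where "strict_mono r" "real_distribution \<nu>"
    "\<And>(f :: real \<Rightarrow> complex) C. (\<And>x. isCont f x) \<Longrightarrow> (\<And>x. norm (f x) \<le> C) \<Longrightarrow>
      (\<lambda>N. \<Sum>i\<le>K (r N). p (r N) i *\<^sub>R f (pt (r N) i)) \<longlonglongrightarrow> integral\<^sup>L \<nu> f"
proof -
  define pm where "pm N = point_measure {..K N} (\<lambda>i. ennreal (p N i))" for N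
  define \<mu> where "\<mu> N = distr (pm N) borel (pt N)" for N
  have pm: "prob_space (pm N)" for N
    unfolding pm_def by (rule prob_space_point_measure) (simp_all add: p sum_ennreal)
  have meas: "pt N \<in> borel_measurable (pm N)" for N
    by (simp add: pm_def)
  have distr: "real_distribution (\<mu> N)" for N
    unfolding \<mu>_def by (rule prob_space.real_distribution_distr[OF pm meas])
  have "tight \<mu>"
    unfolding tight_def
  proof (intro conjI allI impI exI)
    fix \<epsilon> :: real and N assume "\<epsilon> > 0"
    have "{a..b} \<noteq> {}" using pt[of 0 0] by auto
    \<comment> \<open>Tightness is phrased with half-open intervals; starting at
      \<open>a - 1\<close> keeps a possible atom at \<open>a\<close> inside.\<close>
    then show "a - 1 < b" by auto
    have "pt N -` {a - 1<..b} \<inter> space (pm N) = space (pm N)"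
      using pt[of _ N] by (force simp: pm_def space_point_measure)
    then have "measure (\<mu> N) {a - 1<..b} = 1"
      unfolding \<mu>_def by (subst measure_distr[OF meas]) (simp_all add: prob_space.prob_space[OF pm])
    then show "1 - \<epsilon> < measure (\<mu> N) {a - 1<..b}" using \<open>\<epsilon> > 0\<close> by simp
  qed (rule distr)
  then obtain r \<nu> where r: "strict_mono r" "real_distribution \<nu>" "weak_conv_m (\<mu> \<circ> id \<circ> r) \<nu>"
    using tight_imp_convergent_subsubsequence[of \<mu> id] strict_mono_id by metis
  show ?thesis
  proof (rule that[OF r(1,2)])
    fix f :: "real \<Rightarrow> complex" and C
    assume f: "\<And>x. isCont f x" "\<And>x. norm (f x) \<le> C"
    have [measurable]: "f \<in> borel_measurable borel"
      using f(1) by (intro borel_measurable_continuous_onI continuous_at_imp_continuous_on) auto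
    have "integral\<^sup>L (\<mu> N) f = (\<Sum>i\<le>K N. p N i *\<^sub>R f (pt N i))" for N
      unfolding \<mu>_def by (subst integral_distr[OF meas])
        (simp_all add: pm_def lebesgue_integral_point_measure_finite p)
    moreover have "(\<lambda>N. integral\<^sup>L ((\<mu> \<circ> id \<circ> r) N) f) \<longlonglongrightarrow> integral\<^sup>L \<nu> f"
      by (rule weak_conv_imp_integral_bdd_continuous_conv[OF _ r(2,3) f]) (simp add: distr)
    ultimately show "(\<lambda>N. \<Sum>i\<le>K (r N). p (r N) i *\<^sub>R f (pt (r N) i)) \<longlonglongrightarrow> integral\<^sup>L \<nu> f"
      by simp
  qed
qed

lemma floor_grid_tendsto:
  fixes x :: real
  assumes "x \<ge> 0"
  shows "(\<lambda>N. real (nat \<lfloor>x * real (Suc N)\<rfloor>) * inverse (real (Suc N))) \<longlonglongrightarrow> x"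
    and "real (nat \<lfloor>x * real (Suc N)\<rfloor>) * inverse (real (Suc N)) \<le> x"
proof -
  have eq: "real (nat \<lfloor>x * real (Suc N)\<rfloor>) = of_int \<lfloor>x * real (Suc N)\<rfloor>" for N
    using assms by simp
  have upper: "real (nat \<lfloor>x * real (Suc N)\<rfloor>) * inverse (real (Suc N)) \<le> x" for N
    unfolding eq using of_int_floor_le[of "x * real (Suc N)"] by (simp add: field_simps del: of_nat_Suc)
  then show "real (nat \<lfloor>x * real (Suc N)\<rfloor>) * inverse (real (Suc N)) \<le> x" .
  have lower: "x - inverse (real (Suc N)) \<le> real (nat \<lfloor>x * real (Suc N)\<rfloor>) * inverse (real (Suc N))" for N
  proof -
    have "x * real (Suc N) - 1 \<le> of_int \<lfloor>x * real (Suc N)\<rfloor>" by linarith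
    then have "(x * real (Suc N) - 1) * inverse (real (Suc N)) \<le> of_int \<lfloor>x * real (Suc N)\<rfloor> * inverse (real (Suc N))"
      by (rule mult_right_mono) simp
    then show ?thesis unfolding eq by (simp add: left_diff_distrib mult.assoc del: of_nat_Suc)
  qed
  show "(\<lambda>N. real (nat \<lfloor>x * real (Suc N)\<rfloor>) * inverse (real (Suc N))) \<longlonglongrightarrow> x"
  proof (rule tendsto_sandwich)
    show "(\<lambda>N. x - inverse (real (Suc N))) \<longlonglongrightarrow> x"
      using tendsto_diff[OF tendsto_const LIMSEQ_inverse_real_of_nat, of x] by simp
    show "(\<lambda>N. x) \<longlonglongrightarrow> x" by (rule tendsto_const)
  qed (auto intro: always_eventually simp del: of_nat_Suc simp: upper lower)
qed

lemma ratio_diff_le: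
  fixes z1 z2 w1 w2 :: complex
  assumes "norm z1 \<ge> 1" "norm z2 \<ge> 1"
  shows "norm (w1 / z1 - w2 / z2) \<le> norm (w1 - w2) + norm w2 * norm (z1 - z2)"
proof -
  have nz: "z1 \<noteq> 0" "z2 \<noteq> 0" using assms by auto
  have le: "norm (w / z1) \<le> norm w" for w
    using assms(1) by (simp add: norm_divide divide_le_eq mult_left_mono[of 1 "norm z1", simplified])
  have "norm (w1 / z1 - w2 / z2) = norm ((w1 - w2) / z1 + ((w2 / z2) * (z2 - z1)) / z1)"
    using nz by (intro arg_cong[where f = norm]) (simp add: field_simps)
  also have "\<dots> \<le> norm (w1 - w2) + norm ((w2 / z2) * (z2 - z1))"
    by (intro order_trans[OF norm_triangle_ineq] add_mono le)
  finally have "norm (w1 / z1 - w2 / z2) \<le> norm (w1 - w2) + norm ((w2 / z2) * (z2 - z1))" .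
  moreover have "norm ((w2 / z2) * (z2 - z1)) \<le> norm w2 * norm (z1 - z2)"
    unfolding norm_mult norm_minus_commute[of z2]
    using assms(2) by (intro mult_right_mono)
      (auto simp: norm_divide divide_le_eq mult_left_mono[of 1 "norm z2", simplified])
  ultimately show ?thesis by linarith
qed

lemma circle_char_continuous: "continuous_on UNIV (circle_char k)"
proof -
  have "continuous_on UNIV (\<lambda>t. circle_char k (abs_circle t))"
    by (simp add: circle_char.abs_eq) (intro continuous_intros)
  then show ?thesis
    by (auto simp: continuous_on_open_vimage open_circle_def vimage_def)
qed

text \<open>The angle is the class of the sum of two representatives; \<open>circle\<close> carries
  no declared addition, hence the existential form.\<close>

lemma circle_char_add: "\<exists>t. circle_char k t = circle_char k t1 * circle_char k t2"
proof -
  have "circle_char k (abs_circle (rep_circle t1 + rep_circle t2))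
      = circle_char k (abs_circle (rep_circle t1)) * circle_char k (abs_circle (rep_circle t2))"
    unfolding circle_char.abs_eq by (simp add: algebra_simps flip: exp_add)
  also have "\<dots> = circle_char k t1 * circle_char k t2"
    by (simp add: Quotient3_abs_rep[OF Quotient3_circle])
  finally show ?thesis by blast
qed

section \<open>Product formula for the normalized radial solutions\<close>

context cone_profile
begin

text \<open>By \<open>v_fun_0\<close> the denominator is the solution for \<lambda> = 0 on the
  half-line; it is at least 1.\<close>

definition v_ratio :: "complex \<Rightarrow> real \<Rightarrow> complex" where
  "v_ratio lam x = v_fun A k lam x / of_real (cosh (c * S x))"

lemma v_fun_continuous: "continuous_on {0..} (v_fun A k lam)"
  using v_fun_is_sol[of lam] by (auto simp: is_sol_def)

lemma v_ratio_continuous: "continuous_on {0..} (v_ratio lam)"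
  unfolding v_ratio_def
  by (intro continuous_intros v_fun_continuous S_cont) auto

lemma dphi_ground_state: "h > 0 \<Longrightarrow> norm (dphi h 0 n) \<ge> 1"
proof -
  assume h: "h > 0"
  obtain x where "x \<ge> 1" "dphi h 0 n = of_real x"
    using discrete_sturm_liouville.dsol_ground_state[OF discretization[OF h], of n]
    by (auto simp: dphi_def)
  then show ?thesis by simp
qed

lemma dphi_ratio_convergence:
  assumes "\<epsilon> > 0" and "B > 0"
  obtains h0 where "h0 > 0"
    "\<And>h n. 0 < h \<Longrightarrow> h < h0 \<Longrightarrow> real n * h \<le> B \<Longrightarrow>
      norm (dphi h lam n / dphi h 0 n - v_ratio lam (real n * h)) < \<epsilon>"
proof -
  have "bounded (v_fun A k lam ` {0..B})"
    by (intro compact_imp_bounded compact_continuous_image continuous_on_subset[OF v_fun_continuous]) auto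
  then obtain V where "\<forall>y\<in>v_fun A k lam ` {0..B}. norm y \<le> V"
    unfolding bounded_iff by blast
  then have V: "\<And>t. t \<in> {0..B} \<Longrightarrow> norm (v_fun A k lam t) \<le> V" by blast
  have V0: "V \<ge> 0" using order_trans[OF norm_ge_zero V[of 0]] assms by simp
  \<comment> \<open>The numerator contributes an error \<open>e\<close>, the denominator at most
    \<open>V * e\<close>.\<close>
  define e where "e = \<epsilon> / (1 + V)"
  have e: "e > 0" "(1 + V) * e = \<epsilon>" using assms V0 by (simp_all add: e_def)
  obtain P P0 where P: "is_sol lam (v_fun A k lam) P" and P0: "is_sol 0 (v_fun A k 0) P0"
    using v_fun_is_sol by metis
  obtain h1 where h1: "h1 > 0" "\<And>h n. 0 < h \<Longrightarrow> h < h1 \<Longrightarrow> real n * h \<le> B \<Longrightarrow>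
      norm (dphi h lam n - v_fun A k lam (real n * h)) < e"
    using dphi_convergence[OF P e(1) assms(2)] by metis
  obtain h2 where h2: "h2 > 0" "\<And>h n. 0 < h \<Longrightarrow> h < h2 \<Longrightarrow> real n * h \<le> B \<Longrightarrow>
      norm (dphi h 0 n - v_fun A k 0 (real n * h)) < e"
    using dphi_convergence[OF P0 e(1) assms(2)] by metis
  show ?thesis
  proof (rule that[of "min h1 h2"])
    fix h n assume h: "0 < h" "h < min h1 h2" "real n * h \<le> B"
    let ?x = "real n * h"
    have x: "?x \<in> {0..B}" using h by simp
    have "norm (dphi h lam n / dphi h 0 n - v_ratio lam ?x)
        \<le> norm (dphi h lam n - v_fun A k lam ?x)
          + norm (v_fun A k lam ?x) * norm (dphi h 0 n - of_real (cosh (c * S ?x)))"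
      unfolding v_ratio_def using dphi_ground_state[OF h(1)] by (intro ratio_diff_le) (auto simp: cosh_real_ge_1)
    also have "\<dots> \<le> norm (dphi h lam n - v_fun A k lam ?x) + V * e"
      using h x h2(2)[of h n] V[OF x] V0 v_fun_0[of ?x] by (intro add_left_mono mult_mono) auto
    also have "\<dots> < e + V * e" using h1(2)[of h n] h by simp
    also have "\<dots> = \<epsilon>" using e(2) by (simp add: algebra_simps)
    finally show "norm (dphi h lam n / dphi h 0 n - v_ratio lam ?x) < \<epsilon>" .
  qed (use h1 h2 in simp)
qed

lemma dphi_product_formula:
  assumes h: "h > 0" and "n \<le> m"
  obtains p :: "nat \<Rightarrow> real" where "\<And>i. p i \<ge> 0" "(\<Sum>i\<le>m + n. p i) = 1"
    "\<And>lam. (\<Sum>i\<le>m + n. p i *\<^sub>R (dphi h lam i / dphi h 0 i))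
      = (dphi h lam m / dphi h 0 m) * (dphi h lam n / dphi h 0 n)"
proof -
  interpret D: discrete_sturm_liouville "\<lambda>n. 1 / \<delta> h n" "\<lambda>n. c\<^sup>2 * (\<delta> h n)\<^sup>2 / 2"
    by (rule discretization[OF h])
  obtain p where p: "\<And>i. p i \<ge> 0" "(\<Sum>i\<le>m + n. p i) = 1"
    "\<And>l. (\<Sum>i\<le>m + n. p i *\<^sub>R (D.dsol l i / D.dsol 0 i))
      = (D.dsol l m / D.dsol 0 m) * (D.dsol l n / D.dsol 0 n)"
    by (rule D.dsol_product_formula[OF assms(2)]) blast
  show ?thesis
    by (rule that[OF p(1,2)]) (unfold dphi_def mult_zero_left, rule p(3))
qed

text \<open>Weak convergence requires test functions that are bounded and continuous on the whole
  line; clamping the argument achieves this without changing \<open>v_ratio\<close> where the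
  discrete weights live.\<close>

theorem radial_product_formula:
  assumes y: "0 \<le> y" "y \<le> x"
  obtains \<nu> where "real_distribution \<nu>"
    "\<And>lam. integral\<^sup>L \<nu> (\<lambda>t. v_ratio lam (max 0 (min (x + y + 1) t))) = v_ratio lam x * v_ratio lam y"
proof -
  \<comment> \<open>The grid points in use stay below \<open>x + y\<close>; the additional 1 keeps
    \<open>B\<close> positive when \<open>x = y = 0\<close>.\<close>
  define B where "B = x + y + 1"
  have B: "B > 0" using y by (simp add: B_def)
  define h where "h N = inverse (real (Suc N))" for N
  have h: "h N > 0" for N by (simp add: h_def)
  define m where "m N = nat \<lfloor>x * real (Suc N)\<rfloor>" for N
  define n where "n N = nat \<lfloor>y * real (Suc N)\<rfloor>" for N
  have mx: "(\<lambda>N. real (m N) * h N) \<longlonglongrightarrow> x" "\<And>N. real (m N) * h N \<le> x"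
    and ny: "(\<lambda>N. real (n N) * h N) \<longlonglongrightarrow> y" "\<And>N. real (n N) * h N \<le> y"
    using floor_grid_tendsto[of x] floor_grid_tendsto[of y] y by (simp_all add: m_def n_def h_def)
  have nm: "n N \<le> m N" for N
    unfolding m_def n_def using y by (intro nat_mono floor_mono mult_right_mono) auto
  have grid: "real i * h N \<in> {0..B}" if "i \<le> m N + n N" for i N
  proof -
    have "real i * h N \<le> real (m N + n N) * h N"
      using that h[of N] by (intro mult_right_mono) auto
    also have "\<dots> \<le> x + y" using mx(2)[of N] ny(2)[of N] by (simp add: algebra_simps)
    finally show ?thesis using h[of N] by (simp add: B_def)
  qed
  define R where "R N lam i = dphi (h N) lam i / dphi (h N) 0 i" for N lam i
  have "\<exists>p. (\<forall>i. p i \<ge> 0) \<and> (\<Sum>i\<le>m N + n N. p i) = (1::real) \<and>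
      (\<forall>lam. (\<Sum>i\<le>m N + n N. p i *\<^sub>R R N lam i) = R N lam (m N) * R N lam (n N))" for N
  proof -
    obtain p where "\<And>i. p i \<ge> 0" "(\<Sum>i\<le>m N + n N. p i) = (1::real)"
        "\<And>lam. (\<Sum>i\<le>m N + n N. p i *\<^sub>R R N lam i) = R N lam (m N) * R N lam (n N)"
      unfolding R_def by (rule dphi_product_formula[OF h[of N] nm[of N]]) blast
    then show ?thesis by blast
  qed
  then obtain p where p: "\<And>N i. p N i \<ge> 0" "\<And>N. (\<Sum>i\<le>m N + n N. p N i) = (1::real)"
      "\<And>N lam. (\<Sum>i\<le>m N + n N. p N i *\<^sub>R R N lam i) = R N lam (m N) * R N lam (n N)"
    by metis
  show ?thesis
  proof (rule finite_distributions_weak_limit[of p "\<lambda>N. m N + n N" "\<lambda>N i. real i * h N" 0 B, OF p(1,2) grid])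
    fix r :: "nat \<Rightarrow> nat" and \<nu>
    assume r: "strict_mono r" "real_distribution \<nu>"
      and lim: "\<And>(f :: real \<Rightarrow> complex) C. (\<And>x. isCont f x) \<Longrightarrow> (\<And>x. norm (f x) \<le> C) \<Longrightarrow>
        (\<lambda>N. \<Sum>i\<le>m (r N) + n (r N). p (r N) i *\<^sub>R f (real i * h (r N))) \<longlonglongrightarrow> integral\<^sup>L \<nu> f"
    show ?thesis
    proof (rule that[OF r(2)])
      fix lam
      define f where "f t = v_ratio lam (max 0 (min B t))" for t
      have "continuous_on UNIV f"
        unfolding f_def by (rule continuous_on_compose2[OF v_ratio_continuous]) (auto intro!: continuous_intros)
      then have f_cont: "isCont f t" for t by (simp add: continuous_on_eq_continuous_at)
      have "bounded (v_ratio lam ` {0..B})"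
        by (intro compact_imp_bounded compact_continuous_image continuous_on_subset[OF v_ratio_continuous]) auto
      then obtain C where "\<forall>y\<in>v_ratio lam ` {0..B}. norm y \<le> C"
        unfolding bounded_iff by blast
      then have f_bound: "norm (f t) \<le> C" for t using B by (simp add: f_def)
      have f_grid: "f t = v_ratio lam t" if "t \<in> {0..B}" for t using that by (simp add: f_def)
      have unif: "\<forall>\<^sub>F N in sequentially. \<forall>i\<le>m N + n N. norm (R N lam i - f (real i * h N)) < e"
        if e: "e > 0" for e
      proof -
        obtain h0 where h0: "h0 > 0" "\<And>h n. 0 < h \<Longrightarrow> h < h0 \<Longrightarrow> real n * h \<le> B \<Longrightarrow>
            norm (dphi h lam n / dphi h 0 n - v_ratio lam (real n * h)) < e"
          using dphi_ratio_convergence[OF e B] by metis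
        have "\<forall>\<^sub>F N in sequentially. h N < h0"
          using order_tendstoD(2)[OF LIMSEQ_inverse_real_of_nat h0(1)] by (simp add: h_def)
        then show ?thesis
        proof eventually_elim
          case (elim N)
          then show ?case using h0(2)[OF h[of N]] grid[of _ N] by (auto simp: R_def f_grid)
        qed
      qed
      have R_lim: "(\<lambda>N. R N lam (j N)) \<longlonglongrightarrow> v_ratio lam z"
        if j: "\<And>N. j N \<le> m N + n N" and z: "(\<lambda>N. real (j N) * h N) \<longlonglongrightarrow> z" "z \<in> {0..B}" for j z
      proof -
        have "(\<lambda>N. R N lam (j N) - f (real (j N) * h N)) \<longlonglongrightarrow> 0"
        proof (rule tendstoI)
          fix e :: real assume "e > 0"
          from unif[OF this] show "\<forall>\<^sub>F N in sequentially. dist (R N lam (j N) - f (real (j N) * h N)) 0 < e"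
            by eventually_elim (simp add: j)
        qed
        from tendsto_add[OF this isCont_tendsto_compose[OF f_cont z(1)]] show ?thesis
          using f_grid[OF z(2)] by simp
      qed
      have "(\<lambda>N. R N lam (m N) * R N lam (n N)) \<longlonglongrightarrow> v_ratio lam x * v_ratio lam y"
        using mx ny y by (intro tendsto_mult R_lim) (auto simp: B_def)
      \<comment> \<open>By the discrete product formula this difference is an average of
        \<open>R N lam i - f (real i * h N)\<close> with probability weights, so the uniform error
        is not amplified.\<close>
      moreover have "(\<lambda>N. R N lam (m N) * R N lam (n N) - (\<Sum>i\<le>m N + n N. p N i *\<^sub>R f (real i * h N))) \<longlonglongrightarrow> 0"
      proof (rule tendstoI)
        fix e :: real assume "e > 0"
        then have "e / 2 > 0" by simp
        from unif[OF this] show "\<forall>\<^sub>F N in sequentially. dist (R N lam (m N) * R N lam (n N)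
            - (\<Sum>i\<le>m N + n N. p N i *\<^sub>R f (real i * h N))) 0 < e"
        proof eventually_elim
          case (elim N)
          have "norm (\<Sum>i\<le>m N + n N. p N i *\<^sub>R (R N lam i - f (real i * h N)))
              \<le> (\<Sum>i\<le>m N + n N. p N i * (e / 2))"
          proof (rule sum_norm_le)
            fix i assume "i \<in> {..m N + n N}"
            then have "norm (R N lam i - f (real i * h N)) \<le> e / 2"
              using elim by (auto intro: less_imp_le)
            then show "norm (p N i *\<^sub>R (R N lam i - f (real i * h N))) \<le> p N i * (e / 2)"
              unfolding norm_scaleR abs_of_nonneg[OF p(1)] by (rule mult_left_mono[OF _ p(1)])
          qed
          also have "\<dots> = e / 2" by (simp add: p(2) flip: sum_distrib_right sum_divide_distrib)
          also have "\<dots> < e" using \<open>e > 0\<close> by simp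
          finally show ?case
            by (simp add: p(3)[symmetric] scaleR_diff_right sum_subtractf)
        qed
      qed
      ultimately have "(\<lambda>N. \<Sum>i\<le>m N + n N. p N i *\<^sub>R f (real i * h N)) \<longlonglongrightarrow> v_ratio lam x * v_ratio lam y"
        using tendsto_diff by fastforce
      then have "((\<lambda>N. \<Sum>i\<le>m N + n N. p N i *\<^sub>R f (real i * h N)) \<circ> r) \<longlonglongrightarrow> v_ratio lam x * v_ratio lam y"
        using r(1) by (rule LIMSEQ_subseq_LIMSEQ)
      then have "integral\<^sup>L \<nu> f = v_ratio lam x * v_ratio lam y"
        using lim[OF f_cont f_bound] by (intro LIMSEQ_unique) (auto simp: o_def)
      then show "integral\<^sup>L \<nu> (\<lambda>t. v_ratio lam (max 0 (min (x + y + 1) t))) = v_ratio lam x * v_ratio lam y"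
        by (simp add: f_def[abs_def] B_def)
    qed
  qed
qed

section \<open>From the radial factor to the cone\<close>

lemma w_product_formula:
  assumes xi: "\<xi>1 \<in> cone_mfd" "\<xi>2 \<in> cone_mfd"
  shows "\<exists>\<gamma> :: (real \<times> circle) measure.
           sets \<gamma> = sets (restrict_space borel cone_mfd) \<and>
           (\<forall>lam. integrable \<gamma> (w_fun A k lam) \<and>
                w_fun A k lam \<xi>1 * w_fun A k lam \<xi>2
                  = (\<integral>\<xi>3. w_fun A k lam \<xi>3 \<partial>\<gamma>))"
proof -
  obtain x1 t1 x2 t2 where \<xi>: "\<xi>1 = (x1, t1)" "\<xi>2 = (x2, t2)" by (metis surj_pair)
  have x: "x1 \<ge> 0" "x2 \<ge> 0" using xi by (auto simp: \<xi> cone_mfd_def)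
  define cl where "cl t = max 0 (min (x1 + x2 + 1) t)" for t
  have cl: "cl t \<in> {0..x1 + x2 + 1}" for t using x by (auto simp: cl_def)
  have cl_cont: "continuous_on UNIV cl" unfolding cl_def by (intro continuous_intros)
  have "\<exists>\<nu>. real_distribution \<nu> \<and> (\<forall>lam. integral\<^sup>L \<nu> (\<lambda>t. v_ratio lam (cl t)) = v_ratio lam x1 * v_ratio lam x2)"
  proof (cases "x2 \<le> x1")
    case True
    obtain \<nu> where "real_distribution \<nu>"
      "\<And>lam. integral\<^sup>L \<nu> (\<lambda>t. v_ratio lam (max 0 (min (x1 + x2 + 1) t))) = v_ratio lam x1 * v_ratio lam x2"
      by (rule radial_product_formula[OF x(2) True]) blast
    then show ?thesis unfolding cl_def by blast
  next
    case False
    then have le: "x1 \<le> x2" by simp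
    obtain \<nu> where "real_distribution \<nu>"
      "\<And>lam. integral\<^sup>L \<nu> (\<lambda>t. v_ratio lam (max 0 (min (x2 + x1 + 1) t))) = v_ratio lam x2 * v_ratio lam x1"
      by (rule radial_product_formula[OF x(1) le]) blast
    then show ?thesis unfolding cl_def add.commute[of x1] mult.commute[of _ "v_ratio _ x2"] by blast
  qed
  then obtain \<nu> where \<nu>: "real_distribution \<nu>"
      "\<And>lam. integral\<^sup>L \<nu> (\<lambda>t. v_ratio lam (cl t)) = v_ratio lam x1 * v_ratio lam x2"
    by blast
  interpret \<nu>: real_distribution \<nu> by (rule \<nu>(1))
  obtain t3 where t3: "circle_char k t3 = circle_char k t1 * circle_char k t2"
    using circle_char_add by blast
  define \<zeta> where "\<zeta> t = cosh (c * S t)" for t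
  have \<zeta>_pos: "\<zeta> t > 0" for t by (simp add: \<zeta>_def)
  have \<zeta>_cont: "continuous_on {0..} \<zeta>" unfolding \<zeta>_def by (intro continuous_intros S_cont)
  \<comment> \<open>This density undoes the normalization: it restores the ground-state factors at
    \<open>x1\<close> and \<open>x2\<close> and removes the one under the integral. It does not
    involve \<lambda>.\<close>
  define g where "g t = \<zeta> x1 * \<zeta> x2 / \<zeta> (cl t)" for t
  \<comment> \<open>The clamp places the image inside \<open>cone_mfd\<close>, although
    \<open>\<nu>\<close> is a distribution on all reals.\<close>
  define T where "T t = (cl t, t3)" for t
  define \<gamma> where "\<gamma> = distr (density \<nu> (\<lambda>t. ennreal (g t))) (restrict_space borel cone_mfd) T"
  have g_nonneg: "g t \<ge> 0" for t using \<zeta>_pos by (simp add: g_def less_imp_le)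
  have g_cont: "continuous_on UNIV g"
    unfolding g_def by (intro continuous_intros continuous_on_compose2[OF \<zeta>_cont cl_cont])
      (use cl \<zeta>_pos in \<open>auto simp: less_imp_neq[symmetric]\<close>)
  have g_meas [measurable]: "g \<in> borel_measurable \<nu>"
    using borel_measurable_continuous_onI[OF g_cont] by simp
  have T_meas: "T \<in> density \<nu> (\<lambda>t. ennreal (g t)) \<rightarrow>\<^sub>M restrict_space borel cone_mfd"
  proof (rule measurable_restrict_space2)
    have "continuous_on UNIV T" unfolding T_def by (intro continuous_intros cl_cont)
    from borel_measurable_continuous_onI[OF this]
    show "T \<in> density \<nu> (\<lambda>t. ennreal (g t)) \<rightarrow>\<^sub>M borel" by simp
  qed (use cl in \<open>auto simp: T_def cone_mfd_def\<close>)
  have main: "integrable \<gamma> (w_fun A k lam) \<and>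
      w_fun A k lam \<xi>1 * w_fun A k lam \<xi>2 = (\<integral>\<xi>3. w_fun A k lam \<xi>3 \<partial>\<gamma>)" for lam
  proof -
    have "continuous_on cone_mfd (w_fun A k lam)"
      unfolding w_fun_def
      by (intro continuous_intros continuous_on_compose2[OF circle_char_continuous]
          continuous_on_compose2[OF v_fun_continuous]) (auto simp: cone_mfd_def)
    then have w_meas: "w_fun A k lam \<in> borel_measurable (restrict_space borel cone_mfd)"
      by (rule borel_measurable_continuous_on_restrict)
    have wT_cont: "continuous_on UNIV (\<lambda>t. w_fun A k lam (T t))"
      unfolding w_fun_def T_def fst_conv snd_conv
      by (intro continuous_intros continuous_on_compose2[OF v_fun_continuous cl_cont])
        (use cl in auto)
    have wT_meas: "(\<lambda>t. w_fun A k lam (T t)) \<in> borel_measurable \<nu>"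
      using borel_measurable_continuous_onI[OF wT_cont] by simp
    have gw: "g t *\<^sub>R w_fun A k lam (T t)
        = (circle_char k t3 * of_real (\<zeta> x1 * \<zeta> x2)) * v_ratio lam (cl t)" for t
      by (simp add: g_def w_fun_def T_def v_ratio_def \<zeta>_def scaleR_conv_of_real)
    have F_cont: "continuous_on UNIV (\<lambda>t. v_ratio lam (cl t))"
      by (rule continuous_on_compose2[OF v_ratio_continuous cl_cont]) (use cl in auto)
    have "bounded (v_ratio lam ` {0..x1 + x2 + 1})"
      by (intro compact_imp_bounded compact_continuous_image continuous_on_subset[OF v_ratio_continuous]) auto
    then obtain C where "\<forall>y\<in>v_ratio lam ` {0..x1 + x2 + 1}. norm y \<le> C"
      unfolding bounded_iff by blast
    then have "norm (v_ratio lam (cl t)) \<le> C" for t using cl by blast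
    then have F_int: "integrable \<nu> (\<lambda>t. v_ratio lam (cl t))"
      using borel_measurable_continuous_onI[OF F_cont] by (intro \<nu>.integrable_const_bound[of _ C]) auto
    have "integrable \<gamma> (w_fun A k lam)"
      unfolding \<gamma>_def integrable_distr_eq[OF T_meas w_meas]
      by (subst integrable_density) (auto simp: wT_meas g_nonneg gw F_int)
    moreover have "(\<integral>\<xi>3. w_fun A k lam \<xi>3 \<partial>\<gamma>) = w_fun A k lam \<xi>1 * w_fun A k lam \<xi>2"
    proof -
      have "(\<integral>\<xi>3. w_fun A k lam \<xi>3 \<partial>\<gamma>) = (\<integral>t. g t *\<^sub>R w_fun A k lam (T t) \<partial>\<nu>)"
        unfolding \<gamma>_def by (subst integral_distr[OF T_meas w_meas], subst integral_density)
          (auto simp: wT_meas g_nonneg)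
      also have "\<dots> = (circle_char k t3 * of_real (\<zeta> x1 * \<zeta> x2)) * (v_ratio lam x1 * v_ratio lam x2)"
        unfolding gw by (simp add: \<nu>(2))
      also have "\<dots> = w_fun A k lam \<xi>1 * w_fun A k lam \<xi>2"
        using \<zeta>_pos[of x1] \<zeta>_pos[of x2] by (simp add: t3 v_ratio_def \<xi> w_fun_def flip: \<zeta>_def)
      finally show ?thesis .
    qed
    ultimately show ?thesis by simp
  qed
  show ?thesis
    by (rule exI[of _ \<gamma>]) (use main in \<open>simp add: \<gamma>_def\<close>)
qed

end

theorem proposition3p1:
  fixes A :: "real \<Rightarrow> real" and k :: nat and \<xi>1 \<xi>2 :: "real \<times> circle"
  assumes A_cont: "continuous_on {0..} A"
    and A_diff: "\<And>x. x > 0 \<Longrightarrow> A differentiable (at x)"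
    and A_C1: "continuous_on {0<..} (deriv A)"
    and A_pos: "\<And>x. x > 0 \<Longrightarrow> A x > 0"
    and A_int: "set_integrable lborel {0<..<1} (\<lambda>x. 1 / A x)"
    and A_log_nonneg: "\<And>x. x > 0 \<Longrightarrow> deriv A x / A x \<ge> 0"
    and A_log_decr: "antimono_on {0<..} (\<lambda>x. deriv A x / A x)"
    and xi: "\<xi>1 \<in> cone_mfd" "\<xi>2 \<in> cone_mfd"
  shows "\<exists>\<gamma> :: (real \<times> circle) measure.
           sets \<gamma> = sets (restrict_space borel cone_mfd) \<and>
           (\<forall>lam. integrable \<gamma> (w_fun A (int k) lam) \<and>
                w_fun A (int k) lam \<xi>1 * w_fun A (int k) lam \<xi>2
                  = (\<integral>\<xi>3. w_fun A (int k) lam \<xi>3 \<partial>\<gamma>))"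
proof -
  have g_cont: "continuous_on {0<..} (\<lambda>x. 1 / A x)"
    by (intro continuous_intros continuous_on_subset[OF A_cont]) (use A_pos in \<open>force+\<close>)
  \<comment> \<open>Near 0 this is \<open>A_int\<close>, whose open interval may be closed since end
    points do not affect the integral; beyond 1 the integrand is continuous.\<close>
  have g_int: "(\<lambda>x. 1 / A x) integrable_on {0..b}" if "b > 1" for b
  proof (rule Henstock_Kurzweil_Integration.integrable_combine[where c = 1])
    show "(\<lambda>x. 1 / A x) integrable_on {0..1}"
      using set_borel_integral_eq_integral(1)[OF A_int] by (simp add: integrable_on_open_interval_real)
    show "(\<lambda>x. 1 / A x) integrable_on {1..b}"
      by (intro integrable_continuous_real continuous_on_subset[OF g_cont]) auto
  qed (use that in auto)
  define S where "S x = integral {0..x} (\<lambda>x. 1 / A x)" for x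
  interpret cone_profile A S "int k"
  proof
    show "continuous_on {0..} S"
      unfolding continuous_on_atLeast_iff
    proof safe
      fix b :: real assume "b > 0"
      have "continuous_on {0..b + 1} S"
        unfolding S_def using \<open>b > 0\<close> by (intro indefinite_integral_continuous_1 g_int) simp
      then show "continuous_on {0..b} S" by (rule continuous_on_subset) auto
    qed
    show "(S has_real_derivative 1 / A x) (at x)" if x: "x > 0" for x
    proof -
      have "continuous (at x) (\<lambda>x. 1 / A x)"
        using g_cont x by (simp add: continuous_on_eq_continuous_at)
      then have "continuous (at x within {0..x + 1} - {}) (\<lambda>x. 1 / A x)"
        by (rule continuous_at_imp_continuous_at_within)
      then have "(S has_vector_derivative 1 / A x) (at x within {0..x + 1} - {})"
        unfolding S_def
        by (intro integral_has_vector_derivative_continuous_at g_int) (use x in auto)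
      moreover have "at x within {0..x + 1} - {} = at x"
        using x by (intro at_within_interior) simp
      ultimately show ?thesis by (simp add: has_real_derivative_iff_has_vector_derivative)
    qed
  qed (use assms in \<open>auto simp: S_def\<close>)
  show ?thesis by (rule w_product_formula[OF xi])
qed

end
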